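(* Let $\gamma:\mathbb{C}^2\to\mathbb{C}^2$ be a polynomial automorphism which is a contraction. Then $\gamma$ has bounded degree growth, i.e. $\sup_{n\ge 0}\deg\gamma^n<+\infty$.
   Context: A polynomial automorphism of $\mathbb{C}^d$ is a bijective polynomial map $\mathbb{C}^d\to\mathbb{C}^d$ whose inverse is also polynomial. If $\gamma$ is given by $(x_1,\dots,x_d)\mapsto (P_1(x_1,\dots,x_d),\dots,P_d(x_1,\dots,x_d))$, its degree $\deg\gamma$ is the largest among the (total) degrees of the polynomials $P_i$. $\gamma^n$ denotes the $n$-th iterate of $\gamma$ under composition. An automorphism $\gamma$ of $\mathbb{C}^d$ is called a contraction if $0$ is its unique fixed point and $\lim_{n\to\infty}\gamma^n(x)=0$ for all $x\in\mathbb{C}^d$. *)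

theory Defs
  imports "HOL-Analysis.Analysis" "HOL-Library.Poly_Mapping"
    "HOL-Computational_Algebra.Polynomial"
begin

text \<open>
  Polynomials over the complex numbers in variables indexed by the finite type \<open>'n\<close>:
  a finitely supported assignment of coefficients to exponent vectors.
\<close>

type_synonym 'n cpoly = "('n \<Rightarrow>\<^sub>0 nat) \<Rightarrow>\<^sub>0 complex"

definition eval_cpoly :: "('n::finite) cpoly \<Rightarrow> complex ^ 'n \<Rightarrow> complex" where
  "eval_cpoly p x =
     (\<Sum>m\<in>Poly_Mapping.keys p.
        Poly_Mapping.lookup p m * (\<Prod>i\<in>UNIV. (x $ i) ^ Poly_Mapping.lookup m i))"

text \<open>The zero polynomial has degree \<open>0\<close>.\<close>

definition total_degree :: "('n::finite) cpoly \<Rightarrow> nat" where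
  "total_degree p =
     Max (insert 0 ((\<lambda>m. \<Sum>i\<in>UNIV. Poly_Mapping.lookup m i) ` Poly_Mapping.keys p))"

definition given_by :: "(complex ^ 'n \<Rightarrow> complex ^ 'n) \<Rightarrow> ('n::finite \<Rightarrow> 'n cpoly) \<Rightarrow> bool" where
  "given_by f P \<longleftrightarrow> (\<forall>x i. f x $ i = eval_cpoly (P i) x)"

definition polynomial_map :: "(complex ^ 'n::finite \<Rightarrow> complex ^ 'n) \<Rightarrow> bool" where
  "polynomial_map f \<longleftrightarrow> (\<exists>P. given_by f P)"

definition polynomial_automorphism :: "(complex ^ 'n::finite \<Rightarrow> complex ^ 'n) \<Rightarrow> bool" where
  "polynomial_automorphism f \<longleftrightarrow> polynomial_map f \<and> bij f \<and> polynomial_map (inv f)"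

text \<open>
  The coordinate polynomials of a polynomial map are unique, since a polynomial vanishing at every point
  of affine space over an infinite field is zero (lemma \<open>given_by_unique\<close> below).
  The degree of a map that is not polynomial is unspecified.
\<close>

definition coordinate_polys :: "(complex ^ 'n::finite \<Rightarrow> complex ^ 'n) \<Rightarrow> 'n \<Rightarrow> 'n cpoly" where
  "coordinate_polys f = (THE P. given_by f P)"

definition map_degree :: "(complex ^ 'n::finite \<Rightarrow> complex ^ 'n) \<Rightarrow> nat" where
  "map_degree f = Max (range (\<lambda>i. total_degree (coordinate_polys f i)))"

definition contraction :: "(complex ^ 'n::finite \<Rightarrow> complex ^ 'n) \<Rightarrow> bool" where
  "contraction f \<longleftrightarrow>
     (\<forall>x. f x = x \<longleftrightarrow> x = 0) \<and> (\<forall>x. (\<lambda>n. (f ^^ n) x) \<longlonglongrightarrow> 0)"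

lemma digits_unique:
  fixes a b :: "nat \<Rightarrow> nat"
  assumes "\<And>k. a k < N" "\<And>k. b k < N"
    and "(\<Sum>k<n. a k * N ^ k) = (\<Sum>k<n. b k * N ^ k)" and "j < n"
  shows "a j = b j"
  using assms
proof (induction n arbitrary: a b j)
  case 0
  then show ?case by simp
next
  case (Suc n)
  have split: "(\<Sum>k<Suc n. c k * N ^ k) = c 0 + N * (\<Sum>k<n. c (Suc k) * N ^ k)"
    for c :: "nat \<Rightarrow> nat"
    by (subst sum.lessThan_Suc_shift) (simp add: sum_distrib_left mult_ac)
  have eq: "a 0 + N * (\<Sum>k<n. a (Suc k) * N ^ k) = b 0 + N * (\<Sum>k<n. b (Suc k) * N ^ k)"
    using Suc.prems(3) unfolding split .
  have lt: "a 0 < N" "b 0 < N"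
    using Suc.prems by blast+
  have z: "a 0 = b 0"
    using arg_cong[OF eq, of "\<lambda>t. t mod N"] lt by simp
  moreover have "(\<Sum>k<n. a (Suc k) * N ^ k) = (\<Sum>k<n. b (Suc k) * N ^ k)"
    using eq z lt by simp
  ultimately have tl: "a (Suc k) = b (Suc k)" if "k < n" for k
    by (intro Suc.IH[of "\<lambda>k. a (Suc k)" "\<lambda>k. b (Suc k)"] Suc.prems(1,2) that)
  show ?case
  proof (cases j)
    case 0
    then show ?thesis
      using z by simp
  next
    case (Suc k)
    then show ?thesis
      using tl \<open>j < Suc n\<close> by blast
  qed
qed

lemma exponent_encoding:
  fixes S :: "('n::finite \<Rightarrow>\<^sub>0 nat) set"
  assumes "finite S"
  obtains w :: "'n \<Rightarrow> nat"
  where "inj_on (\<lambda>m. \<Sum>i\<in>UNIV. w i * Poly_Mapping.lookup m i) S"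
proof -
  obtain h :: "nat \<Rightarrow> 'n" where h: "bij_betw h {..<CARD('n)} UNIV"
    using ex_bij_betw_nat_finite[of "UNIV :: 'n set"] by (auto simp: atLeast0LessThan)
  define g where "g = the_inv_into {..<CARD('n)} h"
  have gh: "g (h k) = k" if "k < CARD('n)" for k
    using that h unfolding g_def by (auto simp: bij_betw_def the_inv_into_f_f)
  define N where "N = Suc (Max (insert 0 ((\<lambda>(m, i). Poly_Mapping.lookup m i) ` (S \<times> UNIV))))"
  have bound: "Poly_Mapping.lookup m i < N" if "m \<in> S" for m i
    unfolding N_def less_Suc_eq_le
    by (rule Max_ge) (use assms that in \<open>auto intro!: image_eqI[of _ _ "(m, i)"]\<close>)
  have enc: "(\<Sum>i\<in>UNIV. N ^ g i * Poly_Mapping.lookup m i)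
      = (\<Sum>k<CARD('n). Poly_Mapping.lookup m (h k) * N ^ k)" for m :: "'n \<Rightarrow>\<^sub>0 nat"
    unfolding sum.reindex_bij_betw[OF h, symmetric]
    by (rule sum.cong) (auto simp: gh mult.commute)
  have "inj_on (\<lambda>m. \<Sum>i\<in>UNIV. N ^ g i * Poly_Mapping.lookup m i) S"
  proof (rule inj_onI)
    fix m m' assume m: "m \<in> S" "m' \<in> S"
      and eq: "(\<Sum>i\<in>UNIV. N ^ g i * Poly_Mapping.lookup m i)
             = (\<Sum>i\<in>UNIV. N ^ g i * Poly_Mapping.lookup m' i)"
    show "m = m'"
    proof (rule poly_mapping_eqI)
      fix i
      obtain k where k: "k < CARD('n)" "i = h k"
        using h by (auto simp: bij_betw_def)
      show "Poly_Mapping.lookup m i = Poly_Mapping.lookup m' i"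
        unfolding k(2)
      proof (rule digits_unique[of "\<lambda>k. Poly_Mapping.lookup m (h k)" N
            "\<lambda>k. Poly_Mapping.lookup m' (h k)" "CARD('n)" k])
        show "(\<Sum>k<CARD('n). Poly_Mapping.lookup m (h k) * N ^ k)
            = (\<Sum>k<CARD('n). Poly_Mapping.lookup m' (h k) * N ^ k)"
          using eq unfolding enc .
      qed (rule bound m k)+
    qed
  qed
  then show thesis
    by (rule that)
qed

lemma eval_cpoly_superset:
  assumes "finite S" "Poly_Mapping.keys p \<subseteq> S"
  shows "eval_cpoly p x =
     (\<Sum>m\<in>S. Poly_Mapping.lookup p m * (\<Prod>i\<in>UNIV. (x $ i) ^ Poly_Mapping.lookup m i))"
  unfolding eval_cpoly_def
  by (rule sum.mono_neutral_left) (use assms in \<open>auto simp: not_in_keys_iff_lookup_eq_zero\<close>)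

lemma eval_cpoly_inject:
  fixes p q :: "'n::finite cpoly"
  assumes "\<And>x. eval_cpoly p x = eval_cpoly q x"
  shows "p = q"
proof -
  define S where "S = Poly_Mapping.keys p \<union> Poly_Mapping.keys q"
  have S: "finite S"
    by (simp add: S_def)
  obtain w :: "'n \<Rightarrow> nat" where
    w: "inj_on (\<lambda>m. \<Sum>i\<in>UNIV. w i * Poly_Mapping.lookup m i) S"
    using exponent_encoding[OF S] .
  define e where "e m = (\<Sum>i\<in>UNIV. w i * Poly_Mapping.lookup m i)" for m :: "'n \<Rightarrow>\<^sub>0 nat"
  define U where "U r = (\<Sum>m\<in>S. monom (Poly_Mapping.lookup r m) (e m))" for r :: "'n cpoly"
  have U: "poly (U r) t = eval_cpoly r (\<chi> i. t ^ w i)" if "Poly_Mapping.keys r \<subseteq> S" for r t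
    by (simp add: U_def eval_cpoly_superset[OF S that] poly_sum poly_monom e_def
        power_sum power_mult)
  have "U p = U q"
    using U assms by (auto simp: S_def poly_eq_poly_eq_iff[symmetric])
  show ?thesis
  proof (rule poly_mapping_eqI)
    fix m
    show "Poly_Mapping.lookup p m = Poly_Mapping.lookup q m"
    proof (cases "m \<in> S")
      case True
      have "coeff (U r) (e m) = Poly_Mapping.lookup r m" for r
      proof -
        have "coeff (U r) (e m) = (\<Sum>m'\<in>S. if m' = m then Poly_Mapping.lookup r m' else 0)"
          unfolding U_def coeff_sum coeff_monom
          by (rule sum.cong) (use w True in \<open>auto simp: e_def inj_on_def\<close>)
        then show ?thesis
          using S True by simp
      qed
      then show ?thesis
        using \<open>U p = U q\<close> by metis
    next
      case False
      then show ?thesis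
        by (simp add: S_def not_in_keys_iff_lookup_eq_zero)
    qed
  qed
qed

lemma given_by_unique:
  assumes "given_by f P" "given_by f Q"
  shows "P = Q"
  by (rule ext, rule eval_cpoly_inject) (use assms in \<open>simp add: given_by_def\<close>)

lemma coordinate_polys_eq:
  assumes "given_by f P"
  shows "coordinate_polys f = P"
  unfolding coordinate_polys_def using assms given_by_unique by blast

end

theory Submission
  imports Defs "HOL-Computational_Algebra.Fundamental_Theorem_Algebra"
begin

text \<open>
  The proof uses the structure of the group of polynomial automorphisms of the plane.  By Jung's
  theorem (\<open>jung\<close>) this group is generated by the swap of the coordinates and the elementary maps
  \<open>(x, y) \<mapsto> (a x + p(y), b y + c)\<close>.  Among all expressions of conjugates of \<open>\<gamma>\<close> in these generators,
  take one with the fewest swaps (\<open>friedland_milnor_trichotomy\<close>).  If the conjugate found is elementary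
  or affine, then its iterates have bounded degree, and conjugation multiplies degrees by at most a
  constant.  Otherwise minimality forces \<open>deg p \<ge> 2\<close> in every elementary factor, because an affine
  factor between two swaps could be rewritten with fewer swaps.  The conjugate is then a composition of
  generalized Henon maps, and on \<open>{|x| \<le> |y|, |y| \<ge> R}\<close> each of these at least doubles \<open>|y|\<close> and preserves
  the inequality \<open>|x| \<le> |y|\<close>: some orbits are unbounded (\<open>henon_word_unbounded\<close>).  For a conjugate of a
  contraction this is impossible, since all its orbits converge.

  Jung's theorem follows by lowering degrees.  Let \<open>f, g\<close> be the coordinates of an automorphism, of
  degrees \<open>p, q\<close>, not both \<open>1\<close>.  It suffices that one degree divides the other and that the larger of
  the two leading forms is then a multiple of a power of the smaller one: subtracting that multiple of
  a power is an elementary change which lowers the degree.  Both facts come from an identity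
  \<open>A(f, g) = x\<close> (or \<open>= y\<close>), whose left side ought to have large degree.  Let \<open>w\<close> be the degree of
  \<open>A(X, Y)\<close> when \<open>X, Y\<close> get the weights \<open>p, q\<close>, and let \<open>k\<close> be the multiplicity of (a value of) the
  leading form of \<open>g\<close> as a root of the weighted top part of \<open>A\<close>.  The \<open>k\<close>-th derivative of \<open>A\<close> in \<open>Y\<close> then
  suffers no cancellation, so that its value at \<open>(f, g)\<close> has degree at least \<open>w - k q\<close>.  On the other
  hand the derivation \<open>h \<mapsto> J(f, h)\<close> kills \<open>f\<close>, which shows that each derivative in \<open>Y\<close> raises the degree
  by at most \<open>p - 2\<close> (\<open>degree_higher_pderiv_le\<close>).  Finally the top part is so sparse that a nonzero
  root of multiplicity \<open>k\<close> costs \<open>k lcm(p, q) \<le> w\<close>.  Together,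
  \<open>k lcm(p, q) + 2 k \<le> 1 + k (p + q)\<close> (\<open>degree_subst_lower_bound\<close>), which excludes \<open>k > 0\<close> if
  neither degree divides the other; and \<open>k = 0\<close> gives \<open>w \<le> 1\<close>, hence a constant \<open>A\<close> (\<open>degrees_divide\<close>).
  This is the inequality of Shestakov and Umirbaev, by an argument of Venereau.  When \<open>p\<close> divides \<open>q\<close>,
  the top part of \<open>A\<close> factors into binomials \<open>Y - r X ^ (q / p)\<close> and monomials; it vanishes at the leading
  forms because \<open>A(f, g)\<close> has degree \<open>1 < w\<close>, so one of the binomials vanishes there
  (\<open>leading_forms_proportional\<close>).
\<close>

section \<open>Polynomial functions of two variables\<close>

inductive degree_bounded :: "nat \<Rightarrow> (complex \<times> complex \<Rightarrow> complex) \<Rightarrow> bool" where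
  degree_bounded_const: "degree_bounded 0 (\<lambda>z. c)"
| degree_bounded_fst: "degree_bounded 1 fst"
| degree_bounded_snd: "degree_bounded 1 snd"
| degree_bounded_add: "degree_bounded d f \<Longrightarrow> degree_bounded d g \<Longrightarrow> degree_bounded d (\<lambda>z. f z + g z)"
| degree_bounded_mult: "degree_bounded d f \<Longrightarrow> degree_bounded e g \<Longrightarrow> degree_bounded (d + e) (\<lambda>z. f z * g z)"
| degree_bounded_mono: "degree_bounded d f \<Longrightarrow> d \<le> e \<Longrightarrow> degree_bounded e f"

lemma degree_bounded_sum:
  assumes "\<And>i. i \<in> I \<Longrightarrow> degree_bounded d (f i)"
  shows "degree_bounded d (\<lambda>z. \<Sum>i\<in>I. f i z)"
  using assms
proof (induction I rule: infinite_finite_induct)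
  case (insert i I)
  then show ?case using degree_bounded_add[of d "f i" "\<lambda>z. \<Sum>i\<in>I. f i z"] by simp
qed (auto intro: degree_bounded_mono[OF degree_bounded_const])

lemma degree_bounded_power: "degree_bounded d f \<Longrightarrow> degree_bounded (n * d) (\<lambda>z. f z ^ n)"
  by (induction n) (use degree_bounded_const degree_bounded_mult in auto)

lemma degree_bounded_cmult: "degree_bounded d f \<Longrightarrow> degree_bounded d (\<lambda>z. c * f z)"
  using degree_bounded_mult[OF degree_bounded_const] by fastforce

lemma degree_bounded_compose:
  assumes "degree_bounded d h" "degree_bounded e f" "degree_bounded e g"
  shows "degree_bounded (d * e) (\<lambda>z. h (f z, g z))"
  using assms(1)
proof induction
  case (degree_bounded_mono d f d')
  then show ?case by (meson degree_bounded.degree_bounded_mono mult_le_mono1)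
next
  case (degree_bounded_mult d f d' g)
  then show ?case by (simp add: add_mult_distrib degree_bounded.degree_bounded_mult)
qed (use assms(2,3) in \<open>auto intro: degree_bounded.degree_bounded_const degree_bounded.degree_bounded_add degree_bounded.degree_bounded_mono[OF degree_bounded.degree_bounded_const]\<close>)

lemma degree_bounded_continuous: "degree_bounded d h \<Longrightarrow> continuous_on UNIV h"
  by (induction rule: degree_bounded.induct) (auto intro!: continuous_intros)

text \<open>
  This reduces identities between polynomial functions on the plane to the fact that a univariate
  polynomial has finitely many zeros.
\<close>

lemma degree_bounded_univariate: "degree_bounded d h \<Longrightarrow> \<exists>q. \<forall>x. h (x, y) = poly q x"
proof (induction rule: degree_bounded.induct)
  case (degree_bounded_const c) show ?case by (rule exI[of _ "[:c:]"]) simp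
next
  case degree_bounded_fst show ?case by (rule exI[of _ "[:0,1:]"]) simp
next
  case degree_bounded_snd show ?case by (rule exI[of _ "[:y:]"]) simp
next
  case (degree_bounded_add d f g)
  then obtain q r where "\<forall>x. f (x, y) = poly q x" "\<forall>x. g (x, y) = poly r x" by blast
  then show ?case by (intro exI[of _ "q + r"]) simp
next
  case (degree_bounded_mult d f e g)
  then obtain q r where "\<forall>x. f (x, y) = poly q x" "\<forall>x. g (x, y) = poly r x" by blast
  then show ?case by (intro exI[of _ "q * r"]) simp
qed

lemma degree_bounded_poly:
  assumes "degree_bounded d f" shows "degree_bounded (degree p * d) (\<lambda>z. poly p (f z))"
  unfolding poly_altdef
  by (intro degree_bounded_sum degree_bounded_cmult degree_bounded_mono[OF degree_bounded_power[OF assms]] mult_le_mono1) simp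

section \<open>The blow-up chart\<close>

definition poly2 :: "complex poly poly \<Rightarrow> complex \<Rightarrow> complex \<Rightarrow> complex" where
  "poly2 F t s = poly (poly F [:t:]) s"

lemma poly2_simps [simp]:
  "poly2 0 t s = 0" "poly2 1 t s = 1"
  "poly2 (F + G) t s = poly2 F t s + poly2 G t s"
  "poly2 (F - G) t s = poly2 F t s - poly2 G t s"
  "poly2 (F * G) t s = poly2 F t s * poly2 G t s"
  "poly2 (F ^ n) t s = poly2 F t s ^ n"
  "poly2 [:a:] t s = poly a s"
  by (simp_all add: poly2_def)

lemma poly2_smult: "poly2 (smult a F) t s = poly a s * poly2 F t s"
  by (simp add: poly2_def)

lemma poly2_eqI:
  assumes "\<And>t s. poly2 F t s = poly2 G t s"
  shows "F = G"
proof -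
  have "poly (F - G) [:t:] = 0" for t
    using assms by (auto simp: poly2_def poly_eq_poly_eq_iff[symmetric])
  then have "range (\<lambda>t::complex. [:t:]) \<subseteq> {x. poly (F - G) x = 0}" by auto
  moreover have "infinite (range (\<lambda>t::complex. [:t:]))"
    by (simp add: infinite_UNIV_char_0 finite_image_iff inj_on_def)
  ultimately have "F - G = 0" using poly_roots_finite finite_subset by blast
  then show ?thesis by simp
qed

text \<open>
  A polynomial function \<open>h\<close> is written in the coordinates \<open>(t, s)\<close> with \<open>(x, y) = (t, t s)\<close>, as an element \<open>F\<close> of
  \<open>\<complex>[s][t]\<close>.  The total degree of \<open>h\<close> is then the degree of \<open>F\<close> in \<open>t\<close>, and the leading coefficient of \<open>F\<close> is
  the dehomogenized leading form of \<open>h\<close>, so that both inherit multiplicativity from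
  univariate polynomials over a domain.  The bound on the inner degrees characterizes the image
  of \<open>\<complex>[x, y]\<close>.
\<close>

definition chart :: "complex poly poly \<Rightarrow> (complex \<times> complex \<Rightarrow> complex) \<Rightarrow> bool" where
  "chart F h \<longleftrightarrow> (\<forall>k. degree (coeff F k) \<le> k) \<and> (\<forall>t s. h (t, t * s) = poly2 F t s)"

lemma chart_unique: "chart F h \<Longrightarrow> (\<And>t s. h (t, t * s) = poly2 G t s) \<Longrightarrow> F = G"
  by (rule poly2_eqI) (simp add: chart_def)

lemma degree_coeff_mult_le:
  fixes F G :: "complex poly poly"
  assumes "\<And>k. degree (coeff F k) \<le> k" "\<And>k. degree (coeff G k) \<le> k"
  shows "degree (coeff (F * G) k) \<le> k"
  unfolding coeff_mult
proof (rule degree_sum_le)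
  fix i assume "i \<in> {..k}"
  then show "degree (coeff F i * coeff G (k - i)) \<le> k"
    using degree_mult_le[of "coeff F i" "coeff G (k - i)"] assms(1)[of i] assms(2)[of "k - i"]
    by (auto intro: order.trans)
qed simp

lemma chart_exists:
  assumes "degree_bounded d h"
  obtains F where "chart F h" "degree F \<le> d"
proof -
  have "\<exists>F. chart F h \<and> degree F \<le> d"
    using assms
  proof induction
    case (degree_bounded_const c)
    have "chart [:[:c:]:] (\<lambda>z. c)" by (simp add: chart_def coeff_pCons split: nat.split)
    then show ?case by (intro exI[of _ "[:[:c:]:]"]) simp
  next
    case degree_bounded_fst
    have "chart [:0,1:] fst" by (simp add: chart_def poly2_def coeff_pCons split: nat.split)
    then show ?case by (intro exI[of _ "[:0,1:]"]) simp
  next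
    case degree_bounded_snd
    have "chart [:0,[:0,1:]:] snd" by (auto simp: chart_def poly2_def coeff_pCons split: nat.split)
    then show ?case by (intro exI[of _ "[:0,[:0,1:]:]"]) simp
  next
    case (degree_bounded_add d f g)
    then obtain F G where "chart F f" "degree F \<le> d" "chart G g" "degree G \<le> d" by blast
    then show ?case by (intro exI[of _ "F + G"]) (auto simp: chart_def intro: degree_add_le)
  next
    case (degree_bounded_mult d f e g)
    then obtain F G where "chart F f" "degree F \<le> d" "chart G g" "degree G \<le> e" by blast
    then show ?case
      by (intro exI[of _ "F * G"])
         (auto simp: chart_def intro!: degree_coeff_mult_le intro: order.trans[OF degree_mult_le] add_mono)
  next
    case (degree_bounded_mono d f e)
    then show ?case using order.trans by blast
  qed
  then show thesis using that by blast
qed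

lemma poly_extend:
  fixes p :: "complex poly"
  assumes "degree p \<le> n" shows "poly p x = (\<Sum>j\<le>n. coeff p j * x ^ j)"
  unfolding poly_altdef using assms by (intro sum.mono_neutral_left) (auto simp: coeff_eq_0)

text \<open>
  The chart misses the points with \<open>x = 0\<close> and \<open>y \<noteq> 0\<close>; for fixed \<open>y\<close> both sides are polynomials in \<open>x\<close>
  which agree for \<open>x \<noteq> 0\<close>.
\<close>

lemma chart_expand:
  assumes h: "degree_bounded d h" and F: "chart F h"
  shows "h (x, y) = (\<Sum>k\<le>degree F. \<Sum>j\<le>k. coeff (coeff F k) j * (x ^ (k - j) * y ^ j))"
proof -
  define D where "D z = h z + (-1) * (\<Sum>k\<le>degree F. \<Sum>j\<le>k. coeff (coeff F k) j * (fst z ^ (k - j) * snd z ^ j))" for z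
  have "degree_bounded (k - j + j) (\<lambda>z. fst z ^ (k - j) * snd z ^ j)" for k j
    using degree_bounded_mult[OF degree_bounded_power[OF degree_bounded_fst, of "k-j"] degree_bounded_power[OF degree_bounded_snd, of "j"]] by simp
  then have monomial: "degree_bounded (max d (degree F)) (\<lambda>z. fst z ^ (k - j) * snd z ^ j)"
    if "k \<le> degree F" "j \<le> k" for k j
    by (rule degree_bounded_mono) (use that in simp)
  have "degree_bounded (max d (degree F)) D"
    unfolding D_def
    by (intro degree_bounded_add degree_bounded_mono[OF h] degree_bounded_cmult degree_bounded_sum) (auto intro: monomial)
  then obtain q where q: "\<And>x. D (x, y) = poly q x" using degree_bounded_univariate by blast
  have inner: "poly (coeff F k) u = (\<Sum>j\<le>k. coeff (coeff F k) j * u ^ j)" for k u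
    using F by (intro poly_extend) (simp add: chart_def)
  have "D (x, y) = 0" if "x \<noteq> 0" for x
  proof -
    have "h (x, y) = poly2 F x (y / x)" using F that unfolding chart_def by (metis nonzero_mult_div_cancel_left times_divide_eq_right)
    also have "\<dots> = (\<Sum>k\<le>degree F. \<Sum>j\<le>k. coeff (coeff F k) j * (y / x) ^ j * x ^ k)"
      unfolding poly2_def poly_altdef[of F] poly_sum poly_mult poly_power
      by (simp add: inner sum_distrib_right)
    also have "\<dots> = (\<Sum>k\<le>degree F. \<Sum>j\<le>k. coeff (coeff F k) j * (x ^ (k - j) * y ^ j))"
    proof (intro sum.cong refl)
      fix k j :: nat assume "j \<in> {..k}"
      then have "x ^ k = x ^ (k - j) * x ^ j" by (simp flip: power_add)
      then show "coeff (coeff F k) j * (y / x) ^ j * x ^ k = coeff (coeff F k) j * (x ^ (k - j) * y ^ j)"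
        using that by (simp add: power_divide)
    qed
    finally show ?thesis by (simp add: D_def)
  qed
  then have "poly q x = 0" if "x \<noteq> 0" for x using q that by simp
  then have "UNIV - {0} \<subseteq> {x. poly q x = 0}" by auto
  moreover have "infinite (UNIV - {0::complex})" by (simp add: infinite_UNIV_char_0)
  ultimately have "q = 0" using poly_roots_finite finite_subset by blast
  then show ?thesis using q[of x] by (simp add: D_def)
qed

section \<open>The Jacobian derivation and degrees of composites\<close>

definition pderiv_inner :: "complex poly poly \<Rightarrow> complex poly poly" where
  "pderiv_inner F = map_poly pderiv F"

lemma coeff_pderiv_inner: "coeff (pderiv_inner F) k = pderiv (coeff F k)"
  by (simp add: pderiv_inner_def coeff_map_poly)

lemma pderiv_inner_simps [simp]:
  "pderiv_inner 0 = 0"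
  "pderiv_inner (F + G) = pderiv_inner F + pderiv_inner G"
  "pderiv_inner [:a:] = [:pderiv a:]"
  by (rule poly_eqI; simp add: coeff_pderiv_inner pderiv_add coeff_pCons split: nat.split)+

lemma pderiv_inner_mult: "pderiv_inner (F * G) = F * pderiv_inner G + G * pderiv_inner F"
proof (rule poly_eqI)
  fix k
  have "(\<Sum>i\<le>k. coeff G (k - i) * pderiv (coeff F i)) = (\<Sum>i\<le>k. coeff G i * pderiv (coeff F (k - i)))"
    by (rule sum.reindex_bij_witness[of _ "\<lambda>i. k - i" "\<lambda>i. k - i"]) auto
  then show "coeff (pderiv_inner (F * G)) k = coeff (F * pderiv_inner G + G * pderiv_inner F) k"
    by (simp add: coeff_pderiv_inner coeff_mult higher_pderiv_sum[of 1, simplified] pderiv_mult sum.distrib)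
qed

lemma degree_pderiv_inner_le: "degree (pderiv_inner F) \<le> degree F"
  by (rule degree_le) (simp add: coeff_pderiv_inner coeff_eq_0)

text \<open>
  The Jacobian determinant with respect to \<open>(t, s)\<close>, which is \<open>t\<close> times the one with respect to
  \<open>(x, y)\<close> because \<open>dx \<and> dy = t dt \<and> ds\<close>.
\<close>

definition jacobian :: "complex poly poly \<Rightarrow> complex poly poly \<Rightarrow> complex poly poly" where
  "jacobian F H = pderiv F * pderiv_inner H - pderiv_inner F * pderiv H"

lemma jacobian_simps [simp]: "jacobian F 0 = 0" "jacobian F F = 0" "jacobian F (H + K) = jacobian F H + jacobian F K"
  by (simp_all add: jacobian_def pderiv_add algebra_simps)

lemma jacobian_mult: "jacobian F (H * K) = H * jacobian F K + K * jacobian F H"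
  by (simp add: jacobian_def pderiv_mult pderiv_inner_mult algebra_simps)

lemma jacobian_const: "degree a = 0 \<Longrightarrow> jacobian F [:a:] = 0"
  by (simp add: jacobian_def pderiv_eq_0_iff[THEN iffD2])

lemma degree_jacobian_le:
  assumes "degree F \<ge> 1"
  shows "degree (jacobian F H) + 1 \<le> degree F + degree H"
proof (cases "degree H = 0")
  case True
  then have "pderiv H = 0" by (simp add: pderiv_eq_0_iff)
  then have "degree (jacobian F H) \<le> degree F - 1 + degree (pderiv_inner H)"
    using degree_mult_le[of "pderiv F" "pderiv_inner H"] by (simp add: jacobian_def degree_pderiv)
  then show ?thesis using assms degree_pderiv_inner_le[of H] by linarith
next
  case False
  have "degree (pderiv F * pderiv_inner H) \<le> degree F + degree H - 1"
    using degree_mult_le[of "pderiv F" "pderiv_inner H"] degree_pderiv_inner_le[of H] assms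
    by (simp add: degree_pderiv)
  moreover have "degree (pderiv_inner F * pderiv H) \<le> degree F + degree H - 1"
    using degree_mult_le[of "pderiv_inner F" "pderiv H"] degree_pderiv_inner_le[of F] False
    by (simp add: degree_pderiv)
  ultimately have "degree (jacobian F H) \<le> degree F + degree H - 1"
    unfolding jacobian_def by (rule degree_diff_le)
  then show ?thesis using False by linarith
qed

text \<open>
  Pull-backs of polynomials in \<open>x, y\<close> are constant on the exceptional line \<open>t = 0\<close>, so their Jacobian is
  divisible by \<open>t\<close>.
\<close>

lemma degree_jacobian_pos:
  assumes "degree (coeff F 0) = 0" "degree (coeff G 0) = 0" "jacobian F G \<noteq> 0"
  shows "degree (jacobian F G) \<ge> 1"
proof (rule ccontr)
  assume "\<not> ?thesis"
  then obtain a where a: "jacobian F G = [:a:]" using degree_eq_zeroE by (metis less_one not_le)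
  have "a = coeff (jacobian F G) 0" using a by simp
  also have "\<dots> = 0"
    using assms(1,2) by (simp add: jacobian_def coeff_pderiv_inner coeff_mult_0 pderiv_eq_0_iff[THEN iffD2])
  finally show False using a assms(3) by simp
qed

text \<open>
  The chain rule for the derivation \<open>jacobian F\<close>, which treats the coefficients of \<open>Q\<close> as constants.
\<close>

lemma jacobian_poly:
  assumes "\<And>j. jacobian F (coeff Q j) = 0"
  shows "jacobian F (poly Q G) = poly (pderiv Q) G * jacobian F G"
  using assms
proof (induction Q)
  case 0
  show ?case by simp
next
  case (pCons a Q)
  have "jacobian F a = 0" using pCons.prems[of 0] by simp
  moreover have "jacobian F (coeff Q j) = 0" for j using pCons.prems[of "Suc j"] by simp
  ultimately show ?case
    using pCons.IH by (simp add: jacobian_mult pderiv_pCons algebra_simps)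
qed

lemma jacobian_of_nat [simp]: "jacobian F (of_nat n) = 0"
  unfolding of_nat_poly by (rule jacobian_const) (simp add: of_nat_poly)

text \<open>
  By the chain rule \<open>jacobian F (poly Q G)\<close> is \<open>poly (pderiv Q) G\<close> times a factor of degree at least \<open>1\<close>,
  while applying \<open>jacobian F\<close> raises the degree by at most \<open>degree F - 1\<close>.  So every derivative raises the
  degree of the value at \<open>G\<close> by at most \<open>degree F - 2\<close>.
\<close>

lemma degree_higher_pderiv_le:
  assumes "degree F \<ge> 1" "degree (jacobian F G) \<ge> 1" "\<And>j. jacobian F (coeff Q j) = 0"
    and "poly ((pderiv ^^ k) Q) G \<noteq> 0"
  shows "poly Q G \<noteq> 0 \<and> degree (poly ((pderiv ^^ k) Q) G) + 2 * k \<le> k * degree F + degree (poly Q G)"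
  using assms(3,4)
proof (induction k arbitrary: Q)
  case 0
  then show ?case by simp
next
  case (Suc k)
  have "jacobian F (coeff (pderiv Q) j) = 0" for j
    using Suc.prems(1) unfolding coeff_pderiv jacobian_mult by (simp del: of_nat_Suc)
  moreover have "poly ((pderiv ^^ k) (pderiv Q)) G \<noteq> 0"
    using Suc.prems(2) by (simp add: funpow_swap1)
  ultimately have IH: "poly (pderiv Q) G \<noteq> 0"
    "degree (poly ((pderiv ^^ k) (pderiv Q)) G) + 2 * k \<le> k * degree F + degree (poly (pderiv Q) G)"
    using Suc.IH[of "pderiv Q"] by blast+
  have J: "jacobian F (poly Q G) = poly (pderiv Q) G * jacobian F G"
    using Suc.prems(1) by (rule jacobian_poly)
  have "jacobian F G \<noteq> 0" using assms(2) by auto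
  then have "degree (poly (pderiv Q) G) + 1 \<le> degree (jacobian F (poly Q G))"
    using IH(1) assms(2) unfolding J by (simp add: degree_mult_eq)
  also have "\<dots> + 1 \<le> degree F + degree (poly Q G)" using assms(1) by (rule degree_jacobian_le)
  finally have "degree (poly (pderiv Q) G) + 2 \<le> degree F + degree (poly Q G)" by simp
  then show ?case using IH J \<open>jacobian F G \<noteq> 0\<close> by (auto simp: funpow_swap1)
qed

text \<open>
  If the outer variable of \<open>Q\<close> has weight \<open>q\<close>, this is the part of \<open>Q\<close> of weight \<open>w\<close>, specialized at the
  point \<open>s\<close>.  By \<open>coeff_poly_weighted_top\<close> it decides whether the terms of degree \<open>w\<close> in \<open>poly Q G\<close> cancel
  at \<open>s\<close>.
\<close>

definition weighted_top :: "nat \<Rightarrow> nat \<Rightarrow> complex \<Rightarrow> complex poly poly poly \<Rightarrow> complex poly" where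
  "weighted_top q w s Q = (\<Sum>j\<le>degree Q. monom (if q * j \<le> w then poly (coeff (coeff Q j) (w - q * j)) s else 0) j)"

lemma coeff_weighted_top:
  "coeff (weighted_top q w s Q) j = (if q * j \<le> w then poly (coeff (coeff Q j) (w - q * j)) s else 0)"
  by (auto simp: weighted_top_def coeff_sum coeff_eq_0)

lemma coeff_mult_le_sum:
  fixes a b :: "'a::comm_semiring_0 poly"
  assumes "degree a \<le> m" "degree b \<le> n"
  shows "coeff (a * b) (m + n) = coeff a m * coeff b n"
proof -
  have "coeff a i * coeff b (m + n - i) = 0" if "i \<le> m + n" "i \<noteq> m" for i
    using that assms by (cases "i < m") (auto simp: coeff_eq_0)
  then have "coeff (a * b) (m + n) = (\<Sum>i\<in>{m}. coeff a i * coeff b (m + n - i))"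
    unfolding coeff_mult by (intro sum.mono_neutral_right) auto
  then show ?thesis by simp
qed

lemma coeff_poly_weighted_top:
  fixes Q :: "complex poly poly poly"
  assumes "\<And>j. coeff Q j \<noteq> 0 \<Longrightarrow> degree (coeff Q j) + degree G * j \<le> w"
  shows "poly (coeff (poly Q G) w) s = poly (weighted_top (degree G) w s Q) (poly (lead_coeff G) s)"
proof -
  let ?q = "degree G"
  have "poly (coeff (coeff Q j * G ^ j) w) s
      = (if ?q * j \<le> w then poly (coeff (coeff Q j) (w - ?q * j)) s else 0) * poly (lead_coeff G) s ^ j" for j
  proof (cases "coeff Q j = 0")
    case False
    then have le: "degree (coeff Q j) \<le> w - ?q * j" "?q * j \<le> w" using assms[of j] by auto
    have "degree (G ^ j) \<le> ?q * j" using degree_power_le[of G j] by (simp add: mult.commute)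
    then have "coeff (coeff Q j * G ^ j) ((w - ?q * j) + ?q * j) = coeff (coeff Q j) (w - ?q * j) * coeff (G ^ j) (?q * j)"
      using le by (intro coeff_mult_le_sum)
    moreover have "coeff (G ^ j) (?q * j) = lead_coeff G ^ j"
    proof (cases "G = 0")
      case False
      then show ?thesis using lead_coeff_power[of G j] by (simp add: degree_power_eq mult.commute)
    qed (simp add: power_0_left)
    ultimately show ?thesis using le by (simp add: poly_power)
  qed simp
  then show ?thesis
    unfolding poly_altdef[of Q] by (simp add: coeff_sum poly_sum weighted_top_def poly_monom)
qed

lemma poly_higher_pderiv_order:
  fixes p :: "complex poly"
  assumes "p \<noteq> 0"
  shows "poly ((pderiv ^^ order a p) p) a \<noteq> 0"
  using assms
proof (induction "order a p" arbitrary: p)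
  case 0
  then show ?case by (metis funpow_0 order_eq_0_iff)
next
  case (Suc k)
  then have "poly p a = 0" by (simp add: order_root)
  then have "degree p \<noteq> 0" using Suc.prems by (metis degree_eq_zeroE pCons_0_0 poly_0 poly_pCons mult_zero_right add_0_right)
  then have ne: "pderiv p \<noteq> 0" by (simp add: pderiv_eq_0_iff)
  then have "order a p = Suc (order a (pderiv p))" using \<open>poly p a = 0\<close> Suc.hyps(2) by (intro order_pderiv) auto
  then have "poly ((pderiv ^^ k) (pderiv p)) a \<noteq> 0"
    using Suc.hyps(1)[of "pderiv p"] Suc.hyps(2) ne by simp
  then show ?case by (simp add: Suc.hyps(2)[symmetric] funpow_Suc_right del: funpow.simps)
qed

lemma of_nat_mult_coeff: "coeff (of_nat n * p) k = of_nat n * coeff p k"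
  by (simp add: of_nat_poly)

lemma weighted_top_higher_pderiv:
  assumes "k * q \<le> w"
  shows "weighted_top q (w - k * q) s ((pderiv ^^ k) Q) = (pderiv ^^ k) (weighted_top q w s Q)"
proof (rule poly_eqI)
  fix j
  have "q * j \<le> w - k * q \<longleftrightarrow> q * (j + k) \<le> w" "w - k * q - q * j = w - q * (j + k)"
    using assms by (auto simp: algebra_simps)
  then show "coeff (weighted_top q (w - k * q) s ((pderiv ^^ k) Q)) j = coeff ((pderiv ^^ k) (weighted_top q w s Q)) j"
    by (simp add: coeff_weighted_top coeff_higher_pderiv pochhammer_of_nat of_nat_mult_coeff del: of_nat_Suc)
qed

lemma pcompose_power_poly: "pcompose (p ^ n) q = pcompose p q ^ n" for p :: "complex poly"
  by (induction n) (simp_all add: pcompose_mult pcompose_1)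

text \<open>
  Up to a monomial factor \<open>T\<close> is a polynomial in the \<open>n\<close>-th power of the variable.  Its nonzero roots
  therefore come in orbits under multiplication with the \<open>n\<close>-th roots of unity, all members of an orbit
  having the same multiplicity.
\<close>

lemma order_sparse_le:
  fixes T :: "complex poly"
  assumes "T \<noteq> 0" "\<beta> \<noteq> 0" "n > 0"
    and sparse: "\<And>i j. coeff T i \<noteq> 0 \<Longrightarrow> coeff T j \<noteq> 0 \<Longrightarrow> i mod n = j mod n"
  shows "order \<beta> T * n \<le> degree T"
proof -
  have ord: "order \<beta> T \<le> order (z * \<beta>) T" if z: "z ^ n = 1" for z
  proof -
    have "z \<noteq> 0" using z assms(3) by (auto simp: power_0_left)
    obtain b where b: "coeff T b \<noteq> 0" using assms(1) by (metis leading_coeff_0_iff)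
    have "coeff (pcompose T [:0, z:]) i = coeff (smult (z ^ b) T) i" for i
    proof (cases "coeff T i = 0")
      case False
      then have "i mod n = b mod n" using sparse b by blast
      then have "z ^ i = z ^ b" using z
        by (metis mod_mult_div_eq power_add power_mult power_one mult.right_neutral)
      then show ?thesis by (simp add: coeff_pcompose_linear)
    qed (simp add: coeff_pcompose_linear)
    then have T: "pcompose T [:0, z:] = smult (z ^ b) T" by (rule poly_eqI)
    let ?m = "order \<beta> T"
    obtain U where U: "T = [:- \<beta>, 1:] ^ ?m * U" using order_1[of \<beta> T] by (auto elim: dvdE)
    let ?y = "[:0, inverse z:]"
    have "pcompose (pcompose T [:0, z:]) ?y = T" using \<open>z \<noteq> 0\<close> by (simp add: pcompose_pCons flip: pcompose_assoc)
    then have "T = smult (z ^ b) (pcompose T ?y)" unfolding T by (simp add: pcompose_smult)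
    also have "\<dots> = smult (z ^ b) ([:- \<beta>, inverse z:] ^ ?m * pcompose U ?y)"
      by (subst U) (simp add: pcompose_mult pcompose_power_poly pcompose_pCons)
    also have "[:- \<beta>, inverse z:] = smult (inverse z) [:- (z * \<beta>), 1:]" using \<open>z \<noteq> 0\<close> by simp
    finally have "[:- (z * \<beta>), 1:] ^ ?m dvd T"
      by (metis dvd_smult dvd_triv_left smult_power mult_smult_left)
    then show ?thesis using assms(1) by (simp add: order_divides)
  qed
  define S where "S = (\<lambda>z. z * \<beta>) ` {z::complex. z ^ n = 1}"
  have fin: "finite S" "card S = n"
    unfolding S_def using assms(2,3) card_roots_unity_eq[of n] finite_roots_unity[of n]
    by (auto simp: card_image inj_on_def)
  have "order \<beta> T * n = (\<Sum>a\<in>S. order \<beta> T)" using fin by simp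
  also have "\<dots> \<le> (\<Sum>a\<in>S. order a T)" by (rule sum_mono) (use ord in \<open>auto simp: S_def\<close>)
  also have "\<dots> = (\<Sum>a\<in>S. count (proots T) a)" using assms(1) by simp
  also have "\<dots> \<le> (\<Sum>a\<in>S \<union> set_mset (proots T). count (proots T) a)"
    by (rule sum_mono2) (use fin in auto)
  also have "\<dots> = (\<Sum>a\<in>set_mset (proots T). count (proots T) a)"
    by (rule sum.mono_neutral_right) (use fin in \<open>auto simp: not_in_iff\<close>)
  also have "\<dots> \<le> degree T" using size_proots_le[of T] by (simp add: size_multiset_overloaded_eq)
  finally show ?thesis .
qed

section \<open>Degrees and leading forms of the coordinates\<close>

definition lift_poly :: "complex poly \<Rightarrow> complex poly poly" where
  "lift_poly a = map_poly (\<lambda>c. [:c:]) a"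

lemma lift_poly_pCons [simp]: "lift_poly 0 = 0" "lift_poly (pCons c a) = pCons [:c:] (lift_poly a)"
  by (simp_all add: lift_poly_def map_poly_pCons)

lemma degree_lift_poly [simp]: "degree (lift_poly a) = degree a"
  unfolding lift_poly_def by (rule degree_map_poly) auto

lemma coeff_lift_poly: "coeff (lift_poly a) i = [:coeff a i:]"
  by (simp add: lift_poly_def coeff_map_poly)

text \<open>
  For \<open>A \<in> \<complex>[X][Y]\<close> this is \<open>A(F, Y)\<close>, a polynomial in \<open>Y\<close> over \<open>\<complex>[s][t]\<close>.  Only the inner variable is
  substituted, so that differentiating in \<open>Y\<close> remains possible.
\<close>

definition subst_poly :: "complex poly poly \<Rightarrow> complex poly poly \<Rightarrow> complex poly poly poly" where
  "subst_poly F A = map_poly (\<lambda>a. pcompose (lift_poly a) F) A"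

lemma coeff_subst_poly: "coeff (subst_poly F A) j = pcompose (lift_poly (coeff A j)) F"
  by (simp add: subst_poly_def coeff_map_poly)

lemma poly2_pCons: "poly2 (pCons a A) v u = poly a u + v * poly2 A v u"
  by (simp add: poly2_def)

lemma poly2_lift: "poly2 (pcompose (lift_poly a) F) t s = poly a (poly2 F t s)"
  by (induction a) (simp_all add: pcompose_pCons)

lemma poly2_subst: "poly2 (poly (subst_poly F A) G) t s = poly2 A (poly2 G t s) (poly2 F t s)"
  by (induction A) (simp_all add: subst_poly_def map_poly_pCons poly2_lift poly2_pCons)

lemma jacobian_subst_coeff: "jacobian F (coeff (subst_poly F A) j) = 0"
proof -
  have "jacobian F (pcompose (lift_poly a) F) = 0" for a
    by (induction a) (simp_all add: pcompose_pCons jacobian_mult jacobian_const)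
  then show ?thesis by (simp add: coeff_subst_poly)
qed

lemma degree_coeff_subst: "degree (coeff (subst_poly F A) j) = degree (coeff A j) * degree F"
  by (simp add: coeff_subst_poly degree_pcompose)

lemma lead_coeff_subst:
  assumes "degree F \<ge> 1"
  shows "coeff (coeff (subst_poly F A) j) (degree (coeff A j) * degree F)
    = smult (lead_coeff (coeff A j)) (lead_coeff F ^ degree (coeff A j))"
  using lead_coeff_comp[of F "lift_poly (coeff A j)"] assms
  by (simp add: coeff_subst_poly degree_pcompose coeff_lift_poly)

definition weight_le :: "nat \<Rightarrow> nat \<Rightarrow> complex poly poly \<Rightarrow> nat \<Rightarrow> bool" where
  "weight_le p q A w \<longleftrightarrow> (\<forall>j. coeff A j \<noteq> 0 \<longrightarrow> degree (coeff A j) * p + q * j \<le> w)"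

lemma weight_exists:
  assumes "A \<noteq> 0"
  obtains w j where "weight_le p q A w" "coeff A j \<noteq> 0" "degree (coeff A j) * p + q * j = w"
proof -
  define S where "S = {j. coeff A j \<noteq> 0}"
  have "finite S" unfolding S_def by (rule finite_subset[of _ "{..degree A}"]) (auto intro: le_degree)
  moreover have "S \<noteq> {}" unfolding S_def using assms leading_coeff_0_iff by blast
  ultimately have "Max ((\<lambda>j. degree (coeff A j) * p + q * j) ` S) \<in> (\<lambda>j. degree (coeff A j) * p + q * j) ` S"
    by (intro Max_in) auto
  then obtain j where "j \<in> S" "Max ((\<lambda>j. degree (coeff A j) * p + q * j) ` S) = degree (coeff A j) * p + q * j" by blast
  moreover have "weight_le p q A (Max ((\<lambda>j. degree (coeff A j) * p + q * j) ` S))"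
    unfolding weight_le_def using \<open>finite S\<close> by (auto simp: S_def intro!: Max_ge)
  ultimately show thesis using that by (auto simp: S_def)
qed

lemma coeff_top_subst:
  assumes "degree F \<ge> 1" "weight_le (degree F) q A w"
  shows "coeff (weighted_top q w s (subst_poly F A)) j =
    (if coeff A j \<noteq> 0 \<and> degree (coeff A j) * degree F + q * j = w
     then lead_coeff (coeff A j) * poly (lead_coeff F) s ^ degree (coeff A j) else 0)"
proof (cases "coeff A j \<noteq> 0 \<and> degree (coeff A j) * degree F + q * j = w")
  case True
  then have "q * j \<le> w" "w - q * j = degree (coeff A j) * degree F" by auto
  then show ?thesis using True assms(1) by (simp add: coeff_weighted_top lead_coeff_subst poly_power)
next
  case False
  have "coeff (coeff (subst_poly F A) j) (w - q * j) = 0" if "q * j \<le> w"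
  proof (cases "coeff A j = 0")
    case False
    then have "degree (coeff A j) * degree F < w - q * j"
      using assms(2) that \<open>\<not> (_ \<and> _)\<close> unfolding weight_le_def
      by (metis le_neq_implies_less less_diff_conv)
    then show ?thesis by (simp add: coeff_eq_0 degree_coeff_subst)
  qed (simp add: coeff_subst_poly)
  then show ?thesis using False by (auto simp: coeff_weighted_top)
qed

lemma subst_weight:
  assumes "weight_le (degree F) q A w" "coeff (subst_poly F A) j \<noteq> 0"
  shows "degree (coeff (subst_poly F A) j) + q * j \<le> w"
proof -
  have "coeff A j \<noteq> 0" using assms(2) by (auto simp: coeff_subst_poly)
  then show ?thesis using assms(1) by (simp add: weight_le_def degree_coeff_subst)
qed

text \<open>
  The witness for \<open>w\<close> is the weighted degree of \<open>A\<close>.  The number \<open>k\<close> is the multiplicity of a nonzero value \<open>\<beta>\<close> of the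
  leading form of \<open>G\<close> as a root of the top part of \<open>A\<close>.  Differentiating \<open>k\<close> times removes
  the cancellation at \<open>\<beta>\<close>, and \<open>degree_higher_pderiv_le\<close> carries the resulting lower bound back to \<open>A(F, G)\<close>.
\<close>

lemma degree_subst_lower_bound:
  assumes "degree F \<ge> 1" "degree G \<ge> 1" "degree (jacobian F G) \<ge> 1" "A \<noteq> 0"
  obtains k w where "weight_le (degree F) (degree G) A w"
    "w + 2 * k \<le> degree (poly (subst_poly F A) G) + k * (degree F + degree G)"
    "k * lcm (degree F) (degree G) \<le> w"
proof -
  let ?p = "degree F" and ?q = "degree G" and ?Q = "subst_poly F A"
  obtain w j0 where w: "weight_le ?p ?q A w" and j0: "coeff A j0 \<noteq> 0" "degree (coeff A j0) * ?p + ?q * j0 = w"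
    using weight_exists[OF assms(4)] .
  have "lead_coeff F * lead_coeff G \<noteq> 0" using assms(1,2) by auto
  then obtain s where "poly (lead_coeff F * lead_coeff G) s \<noteq> 0" using poly_all_0_iff_0 by blast
  then have s: "poly (lead_coeff F) s \<noteq> 0" "poly (lead_coeff G) s \<noteq> 0" by auto
  define T where "T = weighted_top ?q w s ?Q"
  define \<beta> where "\<beta> = poly (lead_coeff G) s"
  define k where "k = order \<beta> T"
  define n where "n = ?p div gcd ?p ?q"
  note coeffT = coeff_top_subst[OF assms(1) w, of s, folded T_def]
  have "coeff T j0 \<noteq> 0" using j0 s by (simp add: coeffT)
  then have T0: "T \<noteq> 0" by auto
  have n: "n * gcd ?p ?q = ?p" "n > 0"
    using assms(1) by (simp_all add: n_def div_greater_zero_iff)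
  \<comment> \<open>The exponents of \<open>Y\<close> in monomials \<open>X^a Y^j\<close> with \<open>a p + j q = w\<close> agree modulo \<open>n = p / gcd p q\<close>.\<close>
  have sparse: "i mod n = j mod n" if ij: "coeff T i \<noteq> 0" "coeff T j \<noteq> 0" "i \<le> j" for i j
  proof -
    obtain a b where ab: "a * ?p + ?q * i = w" "b * ?p + ?q * j = w"
      using ij(1,2) unfolding coeffT by metis
    define d m where "d = gcd ?p ?q" and "m = ?q div d"
    have d: "?q = m * d" "coprime n m" "d > 0" "?p = n * d"
      using assms(1) n div_gcd_coprime[of ?p ?q] by (auto simp: d_def m_def n_def)
    have "d * (a * n + m * i) = a * ?p + ?q * i" "d * (b * n + m * j) = b * ?p + ?q * j"
      unfolding d(1,4) by (simp_all add: algebra_simps)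
    then have "d * (a * n + m * i) = d * (b * n + m * j)" using ab by simp
    then have eq: "a * n + m * i = b * n + m * j" using d(3) by simp
    have "m * (j - i) = (a - b) * n" using eq ij(3)
      by (simp add: diff_mult_distrib diff_mult_distrib2)
    then have "n dvd m * (j - i)" by simp
    then have "n dvd j - i" using d(2) by (simp add: coprime_dvd_mult_right_iff)
    then show ?thesis using ij(3) by (metis mod_eq_dvd_iff_nat)
  qed
  have "k * n \<le> degree T"
    unfolding k_def
  proof (rule order_sparse_le[OF T0 _ n(2)])
    show "\<beta> \<noteq> 0" using s by (simp add: \<beta>_def)
    show "i mod n = j mod n" if "coeff T i \<noteq> 0" "coeff T j \<noteq> 0" for i j
    proof (cases "i \<le> j")
      case True
      then show ?thesis using that by (intro sparse)
    next
      case False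
      then have "j mod n = i mod n" using that by (intro sparse) simp_all
      then show ?thesis by (rule sym)
    qed
  qed
  then have "?q * (k * n) \<le> ?q * degree T" by (rule mult_le_mono2)
  also have "coeff T (degree T) \<noteq> 0" using T0 by simp
  then have "degree (coeff A (degree T)) * ?p + ?q * degree T = w"
    unfolding coeffT by (auto split: if_splits)
  then have "?q * degree T \<le> w" by simp
  finally have knq: "?q * (k * n) \<le> w" .
  have "gcd ?p ?q * lcm ?p ?q = gcd ?p ?q * (n * ?q)"
    unfolding prod_gcd_lcm_nat[symmetric] by (subst n(1)[symmetric]) (simp add: mult_ac)
  moreover have "gcd ?p ?q \<noteq> 0" using assms(1) by auto
  ultimately have "lcm ?p ?q = n * ?q" using mult_left_cancel by blast
  then have klcm: "k * lcm ?p ?q \<le> w" using knq by (simp add: mult_ac)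
  have "k * ?q \<le> ?q * (k * n)" using n(2) by simp
  then have kq: "k * ?q \<le> w" using knq by (rule order.trans)
  define Q' where "Q' = (pderiv ^^ k) ?Q"
  have "degree (coeff Q' j) + ?q * j \<le> w - k * ?q" if "coeff Q' j \<noteq> 0" for j
  proof -
    have eq: "coeff Q' j = of_nat (pochhammer (Suc j) k) * coeff ?Q (j + k)"
      by (simp add: Q'_def coeff_higher_pderiv pochhammer_of_nat del: of_nat_Suc)
    then have "coeff ?Q (j + k) \<noteq> 0" using that by auto
    moreover have "degree (coeff Q' j) \<le> degree (coeff ?Q (j + k))"
      unfolding eq of_nat_poly by (simp add: degree_smult_le)
    ultimately show ?thesis using subst_weight[OF w, of "j + k"] by (simp add: algebra_simps)
  qed
  then have "poly (coeff (poly Q' G) (w - k * ?q)) s = poly (weighted_top ?q (w - k * ?q) s Q') \<beta>"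
    unfolding \<beta>_def by (rule coeff_poly_weighted_top)
  also have "\<dots> = poly ((pderiv ^^ k) T) \<beta>"
    unfolding Q'_def T_def using kq by (simp add: weighted_top_higher_pderiv)
  also have "\<dots> \<noteq> 0" unfolding k_def using T0 by (rule poly_higher_pderiv_order)
  finally have "coeff (poly Q' G) (w - k * ?q) \<noteq> 0" by auto
  then have "w - k * ?q \<le> degree (poly Q' G)" "poly Q' G \<noteq> 0" by (auto intro: le_degree)
  moreover from this have "degree (poly Q' G) + 2 * k \<le> k * ?p + degree (poly ?Q G)"
    unfolding Q'_def using degree_higher_pderiv_le[OF assms(1,3) jacobian_subst_coeff] by blast
  ultimately have "w + 2 * k \<le> degree (poly ?Q G) + k * (?p + ?q)"
    using kq by (simp add: algebra_simps)
  then show thesis using that w klcm by blast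
qed

text \<open>
  If neither degree divides the other, then the least common multiple is at least twice the larger
  degree, hence at least their sum.  The lower bound then leaves only \<open>k = 0\<close> and weighted degree at
  most \<open>1\<close>, that is a constant \<open>A\<close>.
\<close>

lemma degrees_divide:
  assumes "degree F \<ge> 2" "degree G \<ge> 2" "degree (jacobian F G) \<ge> 1"
    and "degree (poly (subst_poly F A) G) = 1"
  shows "degree F dvd degree G \<or> degree G dvd degree F"
proof (rule ccontr)
  assume nd: "\<not> ?thesis"
  let ?p = "degree F" and ?q = "degree G"
  have "A \<noteq> 0" using assms(4) by (auto simp: subst_poly_def)
  then obtain k w where w: "weight_le ?p ?q A w" and
    kw: "w + 2 * k \<le> 1 + k * (?p + ?q)" "k * lcm ?p ?q \<le> w"
    using degree_subst_lower_bound[of F G A] assms by (metis One_nat_def Suc_1 Suc_leD)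
  have mult: "2 * a \<le> lcm a b" if "\<not> b dvd a" "b > 0" "a > 0" for a b :: nat
  proof -
    obtain c where c: "lcm a b = a * c" by (meson dvdE dvd_lcm1)
    have "c \<noteq> 0" using c that by (metis lcm_eq_0_iff mult_0_right neq0_conv)
    moreover have "c \<noteq> 1" using c that by (metis dvd_lcm2 mult.right_neutral)
    ultimately have "c \<ge> 2" by linarith
    then show ?thesis using c by simp
  qed
  have "2 * ?p \<le> lcm ?p ?q" "2 * ?q \<le> lcm ?p ?q"
    using mult[of ?q ?p] mult[of ?p ?q] nd assms(1,2) by (auto simp: lcm.commute)
  then have "k * (?p + ?q) \<le> k * lcm ?p ?q" by (intro mult_le_mono2) simp
  then have "k = 0" using kw by linarith
  then have "w \<le> 1" using kw by simp
  have small: "degree (coeff A j) = 0 \<and> j = 0" if "coeff A j \<noteq> 0" for j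
  proof -
    have "degree (coeff A j) * ?p + ?q * j \<le> 1"
      using w that \<open>w \<le> 1\<close> unfolding weight_le_def by (meson le_trans)
    moreover have "degree (coeff A j) * 2 \<le> degree (coeff A j) * ?p" "2 * j \<le> ?q * j"
      using assms(1,2) by (auto intro: mult_le_mono)
    ultimately show ?thesis by linarith
  qed
  have "coeff A (degree A) \<noteq> 0" using \<open>A \<noteq> 0\<close> by simp
  then have "degree A = 0" using small by blast
  then obtain a where a: "A = [:a:]" by (auto elim: degree_eq_zeroE)
  then have "degree a = 0" using small[of 0] \<open>A \<noteq> 0\<close> by simp
  then obtain c where "A = [:[:c:]:]" using a by (auto elim: degree_eq_zeroE)
  then have "degree (poly (subst_poly F A) G) = 0" by (simp add: subst_poly_def map_poly_pCons)
  then show False using assms(4) by simp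
qed

text \<open>
  The weighted degree of \<open>A\<close> exceeds \<open>1\<close>, so the top terms of \<open>A(F, G)\<close> cancel identically.  Dividing by a
  power of the leading form \<open>\<alpha>\<close> of \<open>F\<close> says that \<open>\<gamma> / \<alpha> ^ m\<close>, where \<open>\<gamma>\<close> is the leading form of \<open>G\<close>, takes values in
  the finite root set of a fixed polynomial \<open>C\<close>; such a rational function is constant.
\<close>

lemma leading_forms_proportional:
  assumes "degree F \<ge> 1" "degree G = m * degree F" "degree G \<ge> 2" "degree A \<ge> 1"
    and "degree (poly (subst_poly F A) G) = 1"
  obtains r where "lead_coeff G = smult r (lead_coeff F ^ m)"
proof -
  let ?p = "degree F" and ?q = "degree G" and ?Q = "subst_poly F A"
  have "A \<noteq> 0" using assms(4) by auto
  then obtain w j0 where w: "weight_le ?p ?q A w" and j0: "coeff A j0 \<noteq> 0" "degree (coeff A j0) * ?p + ?q * j0 = w"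
    using weight_exists[of A ?p ?q] by blast
  have "coeff A (degree A) \<noteq> 0" using \<open>A \<noteq> 0\<close> by simp
  then have "?q * degree A \<le> w" using w unfolding weight_le_def by (meson add_leD2)
  moreover have "?q * 1 \<le> ?q * degree A" using assms(4) by (intro mult_le_mono2)
  ultimately have "w \<ge> 2" using assms(3) by linarith
  define top where "top j \<longleftrightarrow> coeff A j \<noteq> 0 \<and> degree (coeff A j) * ?p + ?q * j = w" for j
  define C where "C = (\<Sum>j\<le>degree A. monom (if top j then lead_coeff (coeff A j) else 0) j)"
  have "j0 \<le> degree A" using j0 by (simp add: le_degree)
  then have "coeff C j0 \<noteq> 0" using j0 by (simp add: C_def coeff_sum top_def)
  then have "C \<noteq> 0" by auto
  define \<alpha> \<gamma> where "\<alpha> = lead_coeff F" and "\<gamma> = lead_coeff G"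
  have "\<alpha> \<noteq> 0" unfolding \<alpha>_def using assms(1) by auto
  have root: "poly C (poly \<gamma> s / poly \<alpha> s ^ m) = 0" if s: "poly \<alpha> s \<noteq> 0" for s
  proof -
    let ?\<rho> = "poly \<gamma> s / poly \<alpha> s ^ m" and ?T = "weighted_top ?q w s ?Q"
    have "coeff (poly ?Q G) w = 0" using \<open>w \<ge> 2\<close> assms(5) by (simp add: coeff_eq_0)
    then have "0 = poly ?T (poly \<gamma> s)"
      using coeff_poly_weighted_top[of ?Q G w s] subst_weight[OF w] by (simp add: \<gamma>_def)
    also have "degree ?T \<le> degree A"
    proof (rule degree_le, intro allI impI)
      fix j assume "degree A < j"
      then have "coeff A j = 0" by (rule coeff_eq_0)
      then show "coeff ?T j = 0" by (simp add: coeff_top_subst[OF assms(1) w])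
    qed
    then have "poly ?T (poly \<gamma> s) = (\<Sum>j\<le>degree A. coeff ?T j * poly \<gamma> s ^ j)" by (rule poly_extend)
    also have "\<dots> = (\<Sum>j\<le>degree A. poly \<alpha> s ^ (w div ?p) * ((if top j then lead_coeff (coeff A j) else 0) * ?\<rho> ^ j))"
    proof (intro sum.cong refl)
      fix j
      show "coeff ?T j * poly \<gamma> s ^ j = poly \<alpha> s ^ (w div ?p) * ((if top j then lead_coeff (coeff A j) else 0) * ?\<rho> ^ j)"
      proof (cases "top j")
        case True
        then have "w = (degree (coeff A j) + m * j) * ?p"
          using assms(2) by (simp add: top_def algebra_simps)
        then have "w div ?p = degree (coeff A j) + m * j" using assms(1) by simp
        then have "poly \<alpha> s ^ (w div ?p) = poly \<alpha> s ^ degree (coeff A j) * (poly \<alpha> s ^ m) ^ j"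
          by (simp add: power_add power_mult)
        then show ?thesis
          using True s by (simp add: coeff_top_subst[OF assms(1) w] top_def \<alpha>_def power_divide)
      qed (auto simp: coeff_top_subst[OF assms(1) w] top_def)
    qed
    also have "\<dots> = poly \<alpha> s ^ (w div ?p) * poly C ?\<rho>"
      by (simp add: C_def poly_sum poly_monom sum_distrib_left)
    finally show ?thesis using s by simp
  qed
  define P where "P = \<alpha> * (\<Prod>r\<in>{r. poly C r = 0}. \<gamma> - smult r (\<alpha> ^ m))"
  have "poly P s = 0" for s
  proof (cases "poly \<alpha> s = 0")
    case False
    then have "poly (\<Prod>r\<in>{r. poly C r = 0}. \<gamma> - smult r (\<alpha> ^ m)) s = 0"
      using root[of s] poly_roots_finite[OF \<open>C \<noteq> 0\<close>]
      by (auto simp: poly_prod poly_power intro!: bexI[of _ "poly \<gamma> s / poly \<alpha> s ^ m"])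
    then show ?thesis by (simp add: P_def)
  qed (simp add: P_def)
  then have "P = 0" using poly_all_0_iff_0 by blast
  then obtain r where "\<gamma> = smult r (\<alpha> ^ m)"
    using \<open>\<alpha> \<noteq> 0\<close> poly_roots_finite[OF \<open>C \<noteq> 0\<close>] by (auto simp: P_def)
  then show thesis using that by (simp add: \<alpha>_def \<gamma>_def)
qed

section \<open>Polynomial automorphisms and Jung's theorem\<close>

type_synonym plane_map = "complex \<times> complex \<Rightarrow> complex \<times> complex"

definition map_bounded :: "nat \<Rightarrow> plane_map \<Rightarrow> bool" where
  "map_bounded d f \<longleftrightarrow> degree_bounded d (\<lambda>z. fst (f z)) \<and> degree_bounded d (\<lambda>z. snd (f z))"

lemma map_bounded_id: "map_bounded 1 id"
  using degree_bounded_fst degree_bounded_snd by (simp add: map_bounded_def)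

lemma map_bounded_mono: "map_bounded d f \<Longrightarrow> d \<le> e \<Longrightarrow> map_bounded e f"
  unfolding map_bounded_def using degree_bounded_mono by blast

lemma map_bounded_compose:
  assumes "map_bounded d f" "map_bounded e g"
  shows "map_bounded (d * e) (f \<circ> g)"
proof -
  have "degree_bounded (d * e) (\<lambda>z. h (g z))" if "degree_bounded d h" for h
    using degree_bounded_compose[OF that, of e "\<lambda>z. fst (g z)" "\<lambda>z. snd (g z)"] assms(2)
    by (simp add: map_bounded_def)
  from this[of "\<lambda>z. fst (f z)"] this[of "\<lambda>z. snd (f z)"] assms(1) show ?thesis
    by (simp add: map_bounded_def)
qed

definition plane_automorphism :: "plane_map \<Rightarrow> bool" where
  "plane_automorphism f \<longleftrightarrow> bij f \<and> (\<exists>d. map_bounded d f) \<and> (\<exists>d. map_bounded d (inv f))"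

lemma plane_automorphism_id: "plane_automorphism id"
  using map_bounded_id by (auto simp: plane_automorphism_def)

lemma plane_automorphism_inv: "plane_automorphism f \<Longrightarrow> plane_automorphism (inv f)"
  by (auto simp: plane_automorphism_def bij_imp_bij_inv inv_inv_eq)

lemma plane_automorphism_compose: "plane_automorphism f \<Longrightarrow> plane_automorphism g \<Longrightarrow> plane_automorphism (f \<circ> g)"
  unfolding plane_automorphism_def using map_bounded_compose by (metis bij_comp o_inv_distrib)

lemma plane_automorphismI:
  assumes "map_bounded d f" "map_bounded e g" "f \<circ> g = id" "g \<circ> f = id"
  shows "plane_automorphism f"
  unfolding plane_automorphism_def using assms o_bij[of g f] inv_unique_comp[of f g] by metis

definition elementary :: "plane_map \<Rightarrow> bool" where
  "elementary e \<longleftrightarrow> (\<exists>a b c p. a \<noteq> 0 \<and> b \<noteq> 0 \<and> e = (\<lambda>(x, y). (a * x + poly p y, b * y + c)))"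

definition affine_automorphism :: "plane_map \<Rightarrow> bool" where
  "affine_automorphism f \<longleftrightarrow> (\<exists>a b c d u v. a * d - b * c \<noteq> 0 \<and> f = (\<lambda>(x, y). (a * x + b * y + u, c * x + d * y + v)))"

lemma elementaryI: "a \<noteq> 0 \<Longrightarrow> b \<noteq> 0 \<Longrightarrow> elementary (\<lambda>(x, y). (a * x + poly p y, b * y + c))"
  unfolding elementary_def by blast

lemma elementary_id: "elementary id"
  unfolding elementary_def by (intro exI[of _ 1] exI[of _ 1] exI[of _ 0]) auto

lemma elementary_compose:
  assumes "elementary f" "elementary g" shows "elementary (f \<circ> g)"
proof -
  obtain a b c p where f: "a \<noteq> 0" "b \<noteq> 0" "f = (\<lambda>(x, y). (a * x + poly p y, b * y + c))"
    using assms(1) by (auto simp: elementary_def)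
  obtain a' b' c' p' where g: "a' \<noteq> 0" "b' \<noteq> 0" "g = (\<lambda>(x, y). (a' * x + poly p' y, b' * y + c'))"
    using assms(2) by (auto simp: elementary_def)
  have eq: "f \<circ> g = (\<lambda>(x, y). ((a * a') * x + poly (smult a p' + pcompose p [:c', b':]) y, (b * b') * y + (b * c' + c)))"
    unfolding f g by (rule ext) (auto simp: poly_pcompose algebra_simps)
  show ?thesis unfolding eq using f(1,2) g(1,2) by (intro elementaryI) simp_all
qed

lemma degree_bounded_linear: "degree_bounded 1 (\<lambda>z. a * fst z + b * snd z + u)"
  by (intro degree_bounded_add degree_bounded_cmult degree_bounded_fst degree_bounded_snd degree_bounded_mono[OF degree_bounded_const]) simp

lemma map_bounded_elementary:
  "map_bounded (max 1 (degree p)) (\<lambda>(x, y). (a * x + poly p y, b * y + c))"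
  unfolding map_bounded_def case_prod_unfold fst_conv snd_conv
  by (intro conjI degree_bounded_add degree_bounded_cmult degree_bounded_mono[OF degree_bounded_fst] degree_bounded_mono[OF degree_bounded_snd]
      degree_bounded_mono[OF degree_bounded_const] degree_bounded_mono[OF degree_bounded_poly[OF degree_bounded_snd]]) auto

lemma plane_automorphism_elementary:
  assumes "elementary e" shows "plane_automorphism e"
proof -
  obtain a b c p where e: "a \<noteq> 0" "b \<noteq> 0" "e = (\<lambda>(x, y). (a * x + poly p y, b * y + c))"
    using assms by (auto simp: elementary_def)
  define g where "g = (\<lambda>(x, y). (inverse a * x + poly (smult (- inverse a) (pcompose p [:- c / b, inverse b:])) y,
     inverse b * y + (- c / b)))"
  have "e \<circ> g = id" "g \<circ> e = id"
    using e(1,2) unfolding e(3) g_def by (auto simp: fun_eq_iff poly_pcompose field_simps)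
  then show ?thesis unfolding e(3) g_def by (intro plane_automorphismI[OF map_bounded_elementary map_bounded_elementary])
qed

lemma plane_automorphism_swap: "plane_automorphism prod.swap"
  by (rule plane_automorphismI[of 1 _ 1 prod.swap]) (use degree_bounded_fst degree_bounded_snd in \<open>auto simp: map_bounded_def\<close>)

text \<open>
  Words in the generators, recorded by their elementary letters; one swap precedes each letter, so the
  length of the list counts the swaps.
\<close>

fun henon_word :: "plane_map list \<Rightarrow> plane_map" where
  "henon_word [] = id"
| "henon_word (e # es) = prod.swap \<circ> e \<circ> henon_word es"

lemma henon_word_append: "henon_word (xs @ ys) = henon_word xs \<circ> henon_word ys"
  by (induction xs) (simp_all add: comp_assoc)

lemma plane_automorphism_henon_word: "\<forall>e\<in>set es. elementary e \<Longrightarrow> plane_automorphism (henon_word es)"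
  by (induction es) (simp_all add: plane_automorphism_compose plane_automorphism_id plane_automorphism_swap plane_automorphism_elementary)

definition tame :: "plane_map \<Rightarrow> bool" where
  "tame f \<longleftrightarrow> (\<exists>e es. elementary e \<and> (\<forall>e'\<in>set es. elementary e') \<and> f = e \<circ> henon_word es)"

lemma tame_elementary: "elementary e \<Longrightarrow> tame f \<Longrightarrow> tame (e \<circ> f)"
proof -
  assume e: "elementary e" and "tame f"
  then obtain e' es where "elementary e'" "\<forall>e'\<in>set es. elementary e'" "f = e' \<circ> henon_word es" unfolding tame_def by blast
  then show ?thesis unfolding tame_def
    by (intro exI[of _ "e \<circ> e'"] exI[of _ es]) (simp add: e elementary_compose comp_assoc)
qed

lemma tame_swap: "tame f \<Longrightarrow> tame (prod.swap \<circ> f)"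
proof -
  assume "tame f"
  then obtain e es where "elementary e" "\<forall>e'\<in>set es. elementary e'" "f = e \<circ> henon_word es" unfolding tame_def by blast
  then show ?thesis unfolding tame_def
    by (intro exI[of _ id] exI[of _ "e # es"]) (auto simp: elementary_id comp_assoc)
qed

lemma tame_if_elementary: "elementary e \<Longrightarrow> tame e"
  unfolding tame_def by (intro exI[of _ e] exI[of _ "[]"]) auto

text \<open>
  The Bruhat decomposition of the affine group with respect to its elementary, that is upper
  triangular, maps.
\<close>

lemma affine_bruhat:
  assumes "affine_automorphism f"
  shows "elementary f \<or> (\<exists>e e'. elementary e \<and> elementary e' \<and> f = e \<circ> prod.swap \<circ> e')"
proof -
  obtain a b c d u v where f: "a * d - b * c \<noteq> 0" "f = (\<lambda>(x, y). (a * x + b * y + u, c * x + d * y + v))"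
    using assms by (auto simp: affine_automorphism_def)
  show ?thesis
  proof (cases "c = 0")
    case True
    have eq: "f = (\<lambda>(x, y). (a * x + poly [:u, b:] y, d * y + v))"
      using True f(2) by (simp add: fun_eq_iff mult.commute add_ac)
    have "elementary f" unfolding eq using True f(1) by (intro elementaryI) auto
    then show ?thesis ..
  next
    case False
    define e where "e = (\<lambda>(x, y). ((b - a * d / c) * x + poly [:u - a * v / c, a / c:] y, 1 * y + 0))"
    define e' where "e' = (\<lambda>(x, y). (c * x + poly [:v, d:] y, 1 * y + (0::complex)))"
    have "b - a * d / c \<noteq> 0" using f(1) False by (simp add: field_simps)
    then have "elementary e" "elementary e'" unfolding e_def e'_def using False by (intro elementaryI; simp)+
    moreover have "f = e \<circ> prod.swap \<circ> e'"
      using False unfolding f(2) e_def e'_def by (auto simp: fun_eq_iff field_simps)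
    ultimately show ?thesis by blast
  qed
qed

lemma degree_bounded_poly2: "degree_bounded d h \<Longrightarrow> \<exists>A. \<forall>u v. h (u, v) = poly2 A v u"
proof (induction rule: degree_bounded.induct)
  case (degree_bounded_const c) show ?case by (rule exI[of _ "[:[:c:]:]"]) simp
next
  case degree_bounded_fst show ?case by (rule exI[of _ "[:[:0,1:]:]"]) simp
next
  case degree_bounded_snd show ?case by (rule exI[of _ "[:0,1:]"]) (simp add: poly2_def)
next
  case (degree_bounded_add d f g)
  then obtain q r where "\<forall>u v. f (u, v) = poly2 q v u" "\<forall>u v. g (u, v) = poly2 r v u" by blast
  then show ?case by (intro exI[of _ "q + r"]) simp
next
  case (degree_bounded_mult d f e g)
  then obtain q r where "\<forall>u v. f (u, v) = poly2 q v u" "\<forall>u v. g (u, v) = poly2 r v u" by blast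
  then show ?case by (intro exI[of _ "q * r"]) simp
qed

lemma chart_degree_pos:
  assumes "degree_bounded d h" "chart F h" "h z \<noteq> h z'"
  shows "degree F \<ge> 1"
proof (rule ccontr)
  assume "\<not> ?thesis"
  then have "degree F = 0" by simp
  then have "h z = coeff (coeff F 0) 0" for z
    using chart_expand[OF assms(1,2), of "fst z" "snd z"] by simp
  then show False using assms(3) by metis
qed

text \<open>
  The components of the inverse map give polynomials \<open>A, B\<close> with \<open>A(F, G) = t\<close> and \<open>B(F, G) = t s\<close>, both of
  degree \<open>1\<close> in \<open>t\<close>.  The same identities show that the Jacobian does not vanish, as otherwise
  \<open>jacobian F\<close> would annihilate \<open>t\<close> and \<open>t s\<close>, forcing \<open>F\<close> to be constant.
\<close>

lemma coordinate_degrees: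
  assumes \<gamma>: "plane_automorphism \<gamma>" and F: "chart F (\<lambda>z. fst (\<gamma> z))" and G: "chart G (\<lambda>z. snd (\<gamma> z))"
  shows "degree F \<ge> 1" "degree G \<ge> 1"
    and "degree F \<ge> 2 \<Longrightarrow> degree G \<ge> 2 \<Longrightarrow> degree F dvd degree G \<or> degree G dvd degree F"
    and "degree G = m * degree F \<Longrightarrow> degree G \<ge> 2 \<Longrightarrow> \<exists>r. lead_coeff G = smult r (lead_coeff F ^ m)"
proof -
  obtain d where d: "degree_bounded d (\<lambda>z. fst (\<gamma> z))" "degree_bounded d (\<lambda>z. snd (\<gamma> z))"
    using \<gamma> by (auto simp: plane_automorphism_def map_bounded_def)
  have bij: "bij \<gamma>" using \<gamma> by (simp add: plane_automorphism_def)
  then obtain z0 z1 z2 where z: "\<gamma> z0 = (0, 0)" "\<gamma> z1 = (1, 0)" "\<gamma> z2 = (0, 1)"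
    by (metis bij_pointE)
  show pF: "degree F \<ge> 1" using chart_degree_pos[OF d(1) F, of z0 z1] z by simp
  show pG: "degree G \<ge> 1" using chart_degree_pos[OF d(2) G, of z0 z2] z by simp
  obtain A B where AB: "\<And>u v. fst (inv \<gamma> (u, v)) = poly2 A v u" "\<And>u v. snd (inv \<gamma> (u, v)) = poly2 B v u"
    using \<gamma> degree_bounded_poly2 unfolding plane_automorphism_def map_bounded_def by metis
  have "inv \<gamma> (poly2 F t s, poly2 G t s) = (t, t * s)" for t s
    using F G bij unfolding chart_def by (metis bij_inv_eq_iff prod.collapse)
  then have AB_t: "poly2 A (poly2 G t s) (poly2 F t s) = t" "poly2 B (poly2 G t s) (poly2 F t s) = t * s" for t s
    unfolding AB[symmetric] by simp_all
  have A: "poly (subst_poly F A) G = [:0, 1:]"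
    by (rule poly2_eqI) (simp add: poly2_subst AB_t poly2_def[of "[:0, 1:]"])
  have B: "poly (subst_poly F B) G = [:0, [:0, 1:]:]"
    by (rule poly2_eqI) (simp add: poly2_subst AB_t poly2_pCons)
  have "jacobian F G \<noteq> 0"
  proof
    assume "jacobian F G = 0"
    then have *: "jacobian F [:0, 1:] = 0" "jacobian F [:0, [:0, 1:]:] = 0"
      using jacobian_poly[OF jacobian_subst_coeff[of F A], of G] jacobian_poly[OF jacobian_subst_coeff[of F B], of G]
      unfolding A B by simp_all
    have i: "pderiv_inner [:0, 1:] = 0" "pderiv_inner [:0, [:0, 1:]:] = [:0, 1:]"
      by (rule poly_eqI; simp add: coeff_pderiv_inner coeff_pCons pderiv_pCons split: nat.split)+
    have "pderiv_inner F = 0" using *(1) by (simp add: jacobian_def i pderiv_pCons)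
    then have "pderiv F = 0" using *(2) by (simp add: jacobian_def i)
    then show False using pF by (simp add: pderiv_eq_0_iff)
  qed
  then have J: "degree (jacobian F G) \<ge> 1"
    using F G by (intro degree_jacobian_pos) (auto simp: chart_def le_zero_eq[symmetric] simp del: le_zero_eq)
  show "degree F dvd degree G \<or> degree G dvd degree F" if "degree F \<ge> 2" "degree G \<ge> 2"
    using degrees_divide[OF that J, of A] by (simp add: A)
  show "\<exists>r. lead_coeff G = smult r (lead_coeff F ^ m)" if m: "degree G = m * degree F" "degree G \<ge> 2"
  proof -
    \<comment> \<open>Otherwise the inverse map would not depend on its second argument.\<close>
    have "degree A \<ge> 1 \<or> degree B \<ge> 1"
    proof (rule ccontr)
      assume "\<not> ?thesis"
      then have "degree A = 0" "degree B = 0" by auto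
      then obtain a b where "A = [:a:]" "B = [:b:]" by (metis degree_eq_zeroE)
      then have "inv \<gamma> (0, 0) = inv \<gamma> (0, 1)" by (simp add: prod_eq_iff AB)
      then show False using bij by (simp add: bij_imp_bij_inv bij_is_inj inj_eq)
    qed
    moreover have "degree (poly (subst_poly F A) G) = 1" "degree (poly (subst_poly F B) G) = 1"
      by (simp_all add: A B)
    ultimately show ?thesis using leading_forms_proportional[OF pF m] by metis
  qed
qed

text \<open>
  Subtracting \<open>r f ^ m\<close> from the second coordinate \<open>g\<close> cancels its leading form and leaves the first
  coordinate unchanged.
\<close>

lemma degree_reduction:
  assumes \<gamma>: "plane_automorphism \<gamma>" and F: "chart F (\<lambda>z. fst (\<gamma> z))" and G: "chart G (\<lambda>z. snd (\<gamma> z))"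
    and "degree F dvd degree G" "degree G \<ge> 2"
  obtains \<gamma>' e G' where "plane_automorphism \<gamma>'" "chart F (\<lambda>z. fst (\<gamma>' z))" "chart G' (\<lambda>z. snd (\<gamma>' z))"
    "degree G' < degree G" "elementary e" "\<gamma> = prod.swap \<circ> e \<circ> prod.swap \<circ> \<gamma>'"
proof -
  obtain m where m: "degree G = m * degree F" using assms(4) by (metis dvdE mult.commute)
  obtain r where r: "lead_coeff G = smult r (lead_coeff F ^ m)"
    using coordinate_degrees(4)[OF \<gamma> F G m assms(5)] by blast
  define e e' where "e = (\<lambda>(x, y). (1 * x + poly (monom r m) y, 1 * y + (0::complex)))"
    and "e' = (\<lambda>(x, y). (1 * x + poly (monom (- r) m) y, 1 * y + (0::complex)))"
  have e: "elementary e" "elementary e'" unfolding e_def e'_def by (intro elementaryI; simp)+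
  define \<gamma>' where "\<gamma>' = prod.swap \<circ> e' \<circ> prod.swap \<circ> \<gamma>"
  have p: "plane_automorphism \<gamma>'" unfolding \<gamma>'_def by (intro plane_automorphism_compose plane_automorphism_swap plane_automorphism_elementary e \<gamma>)
  have comp: "fst (\<gamma>' z) = fst (\<gamma> z)" "snd (\<gamma>' z) = snd (\<gamma> z) - r * fst (\<gamma> z) ^ m" for z
    by (simp_all add: \<gamma>'_def e'_def case_prod_unfold poly_monom)
  have F': "chart F (\<lambda>z. fst (\<gamma>' z))" using F by (simp add: comp)
  obtain d where "degree_bounded d (\<lambda>z. snd (\<gamma>' z))" using p by (auto simp: plane_automorphism_def map_bounded_def)
  then obtain G' where G': "chart G' (\<lambda>z. snd (\<gamma>' z))" by (rule chart_exists)
  have "G' = G - [:[:r:]:] * F ^ m"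
    by (rule chart_unique[OF G']) (use F G in \<open>simp add: comp chart_def poly2_smult\<close>)
  moreover have "F \<noteq> 0" using coordinate_degrees(1)[OF \<gamma> F G] by auto
  then have dF: "degree (F ^ m) = degree G" by (simp add: m degree_power_eq)
  ultimately have "coeff G' (degree G) = 0"
    using r lead_coeff_power[of F m] by simp
  moreover have "degree G' \<le> degree G"
    using \<open>G' = _\<close> dF by (simp add: degree_diff_le degree_smult_le)
  ultimately have "degree G' < degree G" using assms(5) eq_zero_or_degree_less by fastforce
  moreover have "\<gamma> = prod.swap \<circ> e \<circ> prod.swap \<circ> \<gamma>'"
    by (rule ext) (simp add: prod_eq_iff e_def case_prod_unfold comp poly_monom)
  ultimately show thesis using that p F' G' e by blast
qed

lemma chart_affine:
  assumes "degree_bounded d h" "chart F h" "degree F \<le> 1"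
  obtains a b u where "\<And>x y. h (x, y) = a * x + b * y + u"
proof -
  have "h (x, y) = coeff (coeff F 1) 0 * x + coeff (coeff F 1) 1 * y + coeff (coeff F 0) 0" for x y
  proof (cases "degree F = 0")
    case True
    then show ?thesis using chart_expand[OF assms(1,2), of x y] by (simp add: coeff_eq_0)
  next
    case False
    then have "degree F = 1" using assms(3) by simp
    then show ?thesis using chart_expand[OF assms(1,2), of x y] by (simp add: algebra_simps)
  qed
  then show thesis by (rule that)
qed

text \<open>
  Induction on the sum of the degrees of the coordinates; when both degrees are \<open>1\<close> the automorphism is
  affine and the Bruhat decomposition applies.
\<close>

theorem jung:
  assumes "plane_automorphism \<gamma>"
  shows "tame \<gamma>"
proof -
  have "tame \<gamma>" if "plane_automorphism \<gamma>" "chart F (\<lambda>z. fst (\<gamma> z))" "chart G (\<lambda>z. snd (\<gamma> z))" for \<gamma> F G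
    using that
  proof (induction "degree F + degree G" arbitrary: \<gamma> F G rule: less_induct)
    case less
    note \<gamma> = less.prems
    note step = coordinate_degrees[OF \<gamma>]
    obtain d where d: "degree_bounded d (\<lambda>z. fst (\<gamma> z))" "degree_bounded d (\<lambda>z. snd (\<gamma> z))"
      using \<gamma>(1) by (auto simp: plane_automorphism_def map_bounded_def)
    consider "degree F \<le> 1" "degree G \<le> 1" | "degree F dvd degree G" "degree G \<ge> 2"
      | "degree G dvd degree F" "degree F \<ge> 2"
    proof (cases "degree F \<ge> 2 \<and> degree G \<ge> 2")
      case True
      then show ?thesis using step(3) that by blast
    next
      case False
      then have "degree F = 1 \<or> degree G = 1" using step(1,2) by linarith
      then show ?thesis using that by (metis One_nat_def Suc_1 not_less_eq_eq one_dvd order.refl)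
    qed
    then show ?case
    proof cases
      case 1
      obtain a b u where f: "\<And>x y. fst (\<gamma> (x, y)) = a * x + b * y + u" using chart_affine[OF d(1) \<gamma>(2) 1(1)] by blast
      obtain c d' v where g: "\<And>x y. snd (\<gamma> (x, y)) = c * x + d' * y + v" using chart_affine[OF d(2) \<gamma>(3) 1(2)] by blast
      have *: "\<gamma> = (\<lambda>(x, y). (a * x + b * y + u, c * x + d' * y + v))"
        by (auto simp: fun_eq_iff prod_eq_iff f g)
      have "a * d' - b * c \<noteq> 0"
      proof
        assume det: "a * d' - b * c = 0"
        have inj: "x = 0 \<and> y = 0" if "a * x + b * y = 0" "c * x + d' * y = 0" for x y
        proof -
          have "\<gamma> (x, y) = \<gamma> (0, 0)" using that by (simp add: *)
          then show ?thesis using \<gamma>(1) by (simp add: plane_automorphism_def bij_is_inj inj_eq)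
        qed
        have "b = 0 \<and> a = 0" using inj[of b "- a"] det by (simp add: algebra_simps)
        moreover have "d' = 0 \<and> c = 0" using inj[of d' "- c"] det by (simp add: algebra_simps)
        ultimately show False using inj[of 1 0] by simp
      qed
      then have "affine_automorphism \<gamma>" unfolding affine_automorphism_def using * by blast
      then show ?thesis
        using affine_bruhat tame_if_elementary tame_elementary tame_swap by (metis comp_assoc)
    next
      case 2
      then obtain \<gamma>' e G' where "plane_automorphism \<gamma>'" "chart F (\<lambda>z. fst (\<gamma>' z))" "chart G' (\<lambda>z. snd (\<gamma>' z))"
        "degree G' < degree G" "elementary e" "\<gamma> = prod.swap \<circ> e \<circ> prod.swap \<circ> \<gamma>'"
        using degree_reduction[OF \<gamma>] by metis
      moreover from this have "tame \<gamma>'" by (intro less.hyps) auto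
      ultimately show ?thesis by (simp add: comp_assoc tame_swap tame_elementary)
    next
      case 3
      have "plane_automorphism (prod.swap \<circ> \<gamma>)" "chart G (\<lambda>z. fst ((prod.swap \<circ> \<gamma>) z))" "chart F (\<lambda>z. snd ((prod.swap \<circ> \<gamma>) z))"
        using \<gamma> by (auto intro: plane_automorphism_compose plane_automorphism_swap)
      from degree_reduction[OF this 3] obtain \<gamma>' e F' where "plane_automorphism \<gamma>'" "chart G (\<lambda>z. fst (\<gamma>' z))" "chart F' (\<lambda>z. snd (\<gamma>' z))"
        "degree F' < degree F" "elementary e" and eq: "prod.swap \<circ> \<gamma> = prod.swap \<circ> e \<circ> prod.swap \<circ> \<gamma>'"
        by metis
      moreover from this have "tame \<gamma>'" by (intro less.hyps) auto
      moreover have "\<gamma> = e \<circ> (prod.swap \<circ> \<gamma>')"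
        using arg_cong[OF eq, of "\<lambda>h. prod.swap \<circ> h"] by (simp add: fun_eq_iff)
      ultimately show ?thesis by (simp add: tame_swap tame_elementary)
    qed
  qed
  moreover obtain d where "degree_bounded d (\<lambda>z. fst (\<gamma> z))" "degree_bounded d (\<lambda>z. snd (\<gamma> z))"
    using assms by (auto simp: plane_automorphism_def map_bounded_def)
  ultimately show ?thesis using assms chart_exists by metis
qed

section \<open>Escape to infinity under compositions of Henon maps\<close>

definition henon_factor :: "plane_map \<Rightarrow> bool" where
  "henon_factor e \<longleftrightarrow> (\<exists>a b c p. degree p \<ge> 2 \<and> e = (\<lambda>(x, y). (a * x + poly p y, b * y + c)))"

lemma elementary_affine_or_henon:
  assumes "elementary e" shows "affine_automorphism e \<or> henon_factor e"
proof -
  obtain a b c p where e: "a \<noteq> 0" "b \<noteq> 0" "e = (\<lambda>(x, y). (a * x + poly p y, b * y + c))"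
    using assms by (auto simp: elementary_def)
  show ?thesis
  proof (cases "degree p \<ge> 2")
    case True
    then show ?thesis using e by (auto simp: henon_factor_def)
  next
    case False
    then have "poly p y = coeff p 0 + coeff p 1 * y" for y
      using poly_extend[of p 1 y] by simp
    then have "e = (\<lambda>(x, y). (a * x + coeff p 1 * y + coeff p 0, 0 * x + b * y + c))"
      by (simp add: e(3) fun_eq_iff add_ac)
    moreover have "a * b - coeff p 1 * 0 \<noteq> 0" using e by simp
    ultimately show ?thesis unfolding affine_automorphism_def by blast
  qed
qed

text \<open>
  For \<open>|x| \<le> |y|\<close> and large \<open>|y|\<close> the term \<open>p(y)\<close> dominates all linear terms.  The estimates are stated
  before the swap, hence with the coordinates of \<open>e z\<close> exchanged.
\<close>

lemma henon_escape:
  assumes "henon_factor e"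
  obtains R where "R \<ge> 1" "\<And>z. norm (snd z) \<ge> R \<Longrightarrow> norm (fst z) \<le> norm (snd z) \<Longrightarrow>
    2 * norm (snd z) \<le> norm (fst (e z)) \<and> norm (snd (e z)) \<le> norm (fst (e z))"
proof -
  obtain a b c p where e: "degree p \<ge> 2" "e = (\<lambda>(x, y). (a * x + poly p y, b * y + c))"
    using assms by (auto simp: henon_factor_def)
  obtain p0 q0 q where p: "p = pCons p0 (pCons q0 q)" by (metis pCons_cases)
  then have "q \<noteq> 0" using e(1) by (auto split: if_splits)
  then obtain r where r: "\<And>y. r \<le> norm y \<Longrightarrow> 2 + norm a + norm b + norm c + norm p0 \<le> norm (poly (pCons q0 q) y)"
    using poly_infinity by blast
  show thesis
  proof (rule that[of "max r 1"])
    fix z :: "complex \<times> complex"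
    assume z: "max r 1 \<le> norm (snd z)" "norm (fst z) \<le> norm (snd z)"
    obtain x y where xy: "z = (x, y)" by fastforce
    have y: "1 \<le> norm y" "r \<le> norm y" "norm x \<le> norm y" using z xy by auto
    have scale: "norm u \<le> norm u * norm y" for u :: complex
      using mult_left_mono[OF y(1), of "norm u"] by simp
    have eq: "poly p y - p0 = y * poly (pCons q0 q) y" by (simp add: p)
    have "norm y * (2 + norm a + norm b + norm c + norm p0) \<le> norm (poly p y - p0)"
      unfolding eq norm_mult by (intro mult_left_mono r y) simp
    moreover have "norm (poly p y - p0) \<le> norm (poly p y) + norm p0" by (rule norm_triangle_ineq4)
    ultimately have p_large: "(2 + norm a + norm b + norm c) * norm y \<le> norm (poly p y)"
      using scale[of p0] by (simp add: algebra_simps)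
    have "norm (poly p y) \<le> norm (a * x + poly p y) + norm (a * x)"
      using norm_triangle_ineq4[of "a * x + poly p y" "a * x"] by simp
    moreover have "norm (a * x) \<le> norm a * norm y"
      unfolding norm_mult by (intro mult_left_mono y) simp
    ultimately have large: "(2 + norm b + norm c) * norm y \<le> norm (a * x + poly p y)"
      using p_large by (simp add: algebra_simps)
    have "norm (b * y + c) \<le> norm b * norm y + norm c"
      using norm_triangle_ineq[of "b * y" c] by (simp add: norm_mult)
    also have "\<dots> \<le> (2 + norm b + norm c) * norm y"
      using scale[of c] y(1) by (simp add: algebra_simps)
    finally have "norm (b * y + c) \<le> norm (a * x + poly p y)" using large by linarith
    moreover have "2 * norm y \<le> (2 + norm b + norm c) * norm y"
      by (intro mult_right_mono) simp_all
    ultimately show "2 * norm (snd z) \<le> norm (fst (e z)) \<and> norm (snd (e z)) \<le> norm (fst (e z))"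
      using large by (simp add: xy e(2))
  qed simp
qed

lemma henon_word_escape:
  assumes "\<forall>e\<in>set es. henon_factor e"
  shows "\<exists>R\<ge>1. \<forall>z. norm (snd z) \<ge> R \<longrightarrow> norm (fst z) \<le> norm (snd z) \<longrightarrow>
    2 ^ length es * norm (snd z) \<le> norm (snd (henon_word es z)) \<and>
    norm (fst (henon_word es z)) \<le> norm (snd (henon_word es z))"
  using assms
proof (induction es)
  case Nil
  show ?case by (intro exI[of _ 1]) simp
next
  case (Cons e es)
  then obtain R where R: "R \<ge> 1" "\<And>z. norm (snd z) \<ge> R \<Longrightarrow> norm (fst z) \<le> norm (snd z) \<Longrightarrow>
    2 ^ length es * norm (snd z) \<le> norm (snd (henon_word es z)) \<and>
    norm (fst (henon_word es z)) \<le> norm (snd (henon_word es z))" by auto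
  obtain S where S: "S \<ge> 1" "\<And>z. norm (snd z) \<ge> S \<Longrightarrow> norm (fst z) \<le> norm (snd z) \<Longrightarrow>
    2 * norm (snd z) \<le> norm (fst (e z)) \<and> norm (snd (e z)) \<le> norm (fst (e z))"
    using henon_escape Cons.prems by (metis list.set_intros(1))
  show ?case
  proof (intro exI[of _ "max R S"] conjI allI impI)
    show "1 \<le> max R S" using R by simp
    fix z :: "complex \<times> complex"
    assume z: "max R S \<le> norm (snd z)" "norm (fst z) \<le> norm (snd z)"
    let ?w = "henon_word es z"
    have w: "2 ^ length es * norm (snd z) \<le> norm (snd ?w)" "norm (fst ?w) \<le> norm (snd ?w)"
      using R(2)[of z] z by auto
    moreover have "1 * norm (snd z) \<le> 2 ^ length es * norm (snd z)" by (intro mult_right_mono) simp_all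
    ultimately have "S \<le> norm (snd ?w)" using z by simp
    then have *: "2 * norm (snd ?w) \<le> norm (fst (e ?w))" "norm (snd (e ?w)) \<le> norm (fst (e ?w))"
      using S(2)[of ?w] w by auto
    show "2 ^ length (e # es) * norm (snd z) \<le> norm (snd (henon_word (e # es) z))"
      using * w by simp
    show "norm (fst (henon_word (e # es) z)) \<le> norm (snd (henon_word (e # es) z))"
      using * by simp
  qed
qed

lemma henon_word_unbounded:
  assumes "\<forall>e\<in>set es. henon_factor e" "es \<noteq> []"
  obtains z where "\<And>n. 2 ^ n \<le> norm (snd ((henon_word es ^^ n) z))"
proof -
  obtain R where R: "R \<ge> 1" "\<And>z. norm (snd z) \<ge> R \<Longrightarrow> norm (fst z) \<le> norm (snd z) \<Longrightarrow>
    2 ^ length es * norm (snd z) \<le> norm (snd (henon_word es z)) \<and>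
    norm (fst (henon_word es z)) \<le> norm (snd (henon_word es z))"
    using henon_word_escape[OF assms(1)] by auto
  have two: "(2::real) \<le> 2 ^ length es" using assms(2) self_le_power[of "2::real" "length es"] by simp
  define z where "z n = (henon_word es ^^ n) (0, of_real R)" for n
  have "2 ^ n * R \<le> norm (snd (z n)) \<and> norm (fst (z n)) \<le> norm (snd (z n))" for n
  proof (induction n)
    case 0
    then show ?case using R(1) by (simp add: z_def)
  next
    case (Suc n)
    have "1 * R \<le> 2 ^ n * R" using R(1) by (intro mult_right_mono) simp_all
    then have "R \<le> norm (snd (z n))" using Suc by simp
    then have *: "2 ^ length es * norm (snd (z n)) \<le> norm (snd (z (Suc n)))"
      "norm (fst (z (Suc n))) \<le> norm (snd (z (Suc n)))"
      using R(2)[of "z n"] Suc by (simp_all add: z_def)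
    have "2 * norm (snd (z n)) \<le> 2 ^ length es * norm (snd (z n))" by (intro mult_right_mono two) simp
    then show ?case using Suc * by simp
  qed
  moreover have "2 ^ n * 1 \<le> 2 ^ n * R" for n :: nat using R(1) by (intro mult_left_mono) simp_all
  ultimately have "2 ^ n \<le> norm (snd (z n))" for n by (metis mult.right_neutral order.trans)
  then show thesis unfolding z_def by (rule that)
qed

section \<open>Conjugation to an elementary map, an affine map or a composition of Henon maps\<close>

definition conjugate :: "plane_map \<Rightarrow> plane_map \<Rightarrow> bool" where
  "conjugate f h \<longleftrightarrow> (\<exists>\<phi>. plane_automorphism \<phi> \<and> f = \<phi> \<circ> h \<circ> inv \<phi>)"

lemma conjugate_refl: "conjugate f f"
  unfolding conjugate_def by (intro exI[of _ id]) (simp add: plane_automorphism_id)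

lemma conjugate_trans:
  assumes "conjugate f g" "conjugate g h" shows "conjugate f h"
proof -
  obtain \<phi> \<psi> where *: "plane_automorphism \<phi>" "f = \<phi> \<circ> g \<circ> inv \<phi>" "plane_automorphism \<psi>" "g = \<psi> \<circ> h \<circ> inv \<psi>"
    using assms by (auto simp: conjugate_def)
  then have "inv (\<phi> \<circ> \<psi>) = inv \<psi> \<circ> inv \<phi>" by (simp add: o_inv_distrib plane_automorphism_def)
  then show ?thesis unfolding conjugate_def using *
    by (intro exI[of _ "\<phi> \<circ> \<psi>"]) (simp add: plane_automorphism_compose comp_assoc)
qed

lemma conjugate_rotate: "plane_automorphism f \<Longrightarrow> conjugate (f \<circ> g) (g \<circ> f)"
  unfolding conjugate_def
  by (intro exI[of _ f]) (simp add: comp_assoc plane_automorphism_def bij_is_surj surj_iff[THEN iffD1])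

lemma affine_automorphism_swap: "affine_automorphism f \<Longrightarrow> affine_automorphism (prod.swap \<circ> f)" "affine_automorphism f \<Longrightarrow> affine_automorphism (f \<circ> prod.swap)"
proof -
  assume "affine_automorphism f"
  then obtain a b c d u v where f: "a * d - b * c \<noteq> 0" "f = (\<lambda>(x, y). (a * x + b * y + u, c * x + d * y + v))"
    by (auto simp: affine_automorphism_def)
  have "prod.swap \<circ> f = (\<lambda>(x, y). (c * x + d * y + v, a * x + b * y + u))" by (auto simp: f(2))
  moreover have "c * b - d * a \<noteq> 0" using f(1) by (simp add: mult.commute)
  ultimately show "affine_automorphism (prod.swap \<circ> f)" unfolding affine_automorphism_def by blast
  have "f \<circ> prod.swap = (\<lambda>(x, y). (b * x + a * y + u, d * x + c * y + v))" by (auto simp: f(2))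
  moreover have "b * c - a * d \<noteq> 0" using f(1) by simp
  ultimately show "affine_automorphism (f \<circ> prod.swap)" unfolding affine_automorphism_def by blast
qed

text \<open>
  A word with the minimal number \<open>N\<close> of swaps is chosen among all words for conjugates of \<open>\<gamma>\<close>.  Rotating a
  word cyclically is a conjugation, so an affine letter \<open>w\<close> can be moved to the front.  If \<open>N = 1\<close>, the
  conjugate is affine.  If \<open>N \<ge> 2\<close>, then \<open>w\<close> stands between two swaps, and the
  affine map \<open>swap w swap\<close> needs at most one swap, contrary to minimality.
\<close>

theorem friedland_milnor_trichotomy:
  assumes "plane_automorphism \<gamma>"
  obtains h where "conjugate \<gamma> h"
    "elementary h \<or> affine_automorphism h \<or> (\<exists>es. es \<noteq> [] \<and> (\<forall>e\<in>set es. henon_factor e) \<and> h = henon_word es)"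
proof -
  define P where "P n \<longleftrightarrow> (\<exists>e es. elementary e \<and> (\<forall>e'\<in>set es. elementary e') \<and> length es = n \<and> conjugate \<gamma> (e \<circ> henon_word es))" for n
  have "\<exists>n. P n" using jung[OF assms] conjugate_refl unfolding tame_def P_def by blast
  then obtain N where N: "P N" and least: "\<And>n. n < N \<Longrightarrow> \<not> P n" using exists_least_iff[of P] by blast
  then obtain e es where es: "elementary e" "\<forall>e'\<in>set es. elementary e'" "length es = N" "conjugate \<gamma> (e \<circ> henon_word es)"
    unfolding P_def by blast
  show thesis
  proof (cases es rule: rev_cases)
    case Nil
    then show thesis using that es by simp
  next
    case (snoc xs z)
    \<comment> \<open>The leading elementary factor is moved to the end of the word and absorbed by the last letter.\<close>
    define es' where "es' = xs @ [z \<circ> e]"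
    have z: "elementary z" "\<forall>e'\<in>set es'. elementary e'" using es snoc by (auto simp: es'_def elementary_compose)
    have "conjugate (e \<circ> henon_word es) (henon_word es')"
      using conjugate_rotate[OF plane_automorphism_elementary[OF es(1)], of "henon_word es"]
      by (simp add: snoc es'_def henon_word_append comp_assoc)
    then have \<gamma>: "conjugate \<gamma> (henon_word es')" using es(4) conjugate_trans by blast
    show thesis
    proof (cases "\<forall>e\<in>set es'. henon_factor e")
      case True
      then show thesis using that[OF \<gamma>] by (metis es'_def snoc_eq_iff_butlast)
    next
      case False
      then obtain w where w: "w \<in> set es'" "affine_automorphism w" using elementary_affine_or_henon z(2) by blast
      then obtain us vs where uv: "es' = us @ w # vs" by (meson split_list)
      have "conjugate (henon_word us \<circ> henon_word (w # vs)) (henon_word (w # vs) \<circ> henon_word us)"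
        using z(2) by (intro conjugate_rotate plane_automorphism_henon_word) (auto simp: uv)
      then have \<gamma>: "conjugate \<gamma> (prod.swap \<circ> w \<circ> henon_word (vs @ us))"
        using \<gamma> conjugate_trans by (simp add: uv henon_word_append comp_assoc)
      have len: "length (vs @ us) = N - 1"
        using es(3) snoc arg_cong[OF uv, of length] by (simp add: es'_def)
      have N: "N \<ge> 1" using es(3) snoc by simp
      show thesis
      proof (cases "vs @ us")
        case Nil
        then show thesis using that[OF \<gamma>] affine_automorphism_swap(1)[OF w(2)] by simp
      next
        case (Cons x xs)
        have el: "elementary x" "\<forall>e\<in>set xs. elementary e"
          using z(2) arg_cong[OF Cons, of set] by (auto simp: uv)
        let ?b = "prod.swap \<circ> w \<circ> prod.swap"
        have \<gamma>b: "conjugate \<gamma> (?b \<circ> x \<circ> henon_word xs)" using \<gamma> by (simp add: Cons comp_assoc)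
        have lx: "length xs = N - 2" "N \<ge> 2" using len N Cons by auto
        consider "elementary ?b" | b b' where "elementary b" "elementary b'" "?b = b \<circ> prod.swap \<circ> b'"
          using affine_bruhat affine_automorphism_swap w(2) by metis
        then show thesis
        proof cases
          case 1
          then have "P (N - 2)" unfolding P_def using el lx \<gamma>b elementary_compose by blast
          then show thesis using least[of "N - 2"] lx by simp
        next
          case 2
          have "conjugate \<gamma> (b \<circ> henon_word ((b' \<circ> x) # xs))" using \<gamma>b unfolding 2(3) by (simp add: comp_assoc)
          moreover have "\<forall>e\<in>set ((b' \<circ> x) # xs). elementary e" using el 2 by (simp add: elementary_compose)
          moreover have "length ((b' \<circ> x) # xs) = N - 1" using lx by simp
          ultimately have "P (N - 1)" unfolding P_def using 2(1) by blast
          then show thesis using least[of "N - 1"] lx by simp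
        qed
      qed
    qed
  qed
qed

section \<open>Bounded degree growth\<close>

definition bounded_degree_growth :: "plane_map \<Rightarrow> bool" where
  "bounded_degree_growth f \<longleftrightarrow> (\<exists>d. \<forall>n. map_bounded d (f ^^ n))"

text \<open>
  A composite of elementary maps with polynomials \<open>p\<close>, \<open>p'\<close> is elementary with a combination of \<open>p'\<close> and
  \<open>p\<close> precomposed with an affine function, so the maximum of the two degrees is not exceeded.
\<close>

lemma bounded_degree_growth_elementary:
  assumes "elementary e" shows "bounded_degree_growth e"
proof -
  obtain a b c p where e: "e = (\<lambda>(x, y). (a * x + poly p y, b * y + c))"
    using assms by (auto simp: elementary_def)
  have iterates: "\<exists>a' b' c' p'. degree p' \<le> degree p \<and> e ^^ n = (\<lambda>(x, y). (a' * x + poly p' y, b' * y + c'))" for n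
  proof (induction n)
    case 0
    have "e ^^ 0 = (\<lambda>(x, y). (1 * x + poly 0 y, 1 * y + 0))" by auto
    then show ?case by (intro exI[of _ 1] exI[of _ 0] exI conjI) simp_all
  next
    case (Suc n)
    then obtain a' b' c' p' where *: "degree p' \<le> degree p" "e ^^ n = (\<lambda>(x, y). (a' * x + poly p' y, b' * y + c'))" by blast
    let ?q = "smult a p' + pcompose p [:c', b':]"
    have "e ^^ Suc n = e \<circ> (\<lambda>(x, y). (a' * x + poly p' y, b' * y + c'))"
      by (simp only: funpow.simps *(2))
    also have "\<dots> = (\<lambda>(x, y). ((a * a') * x + poly ?q y, (b * b') * y + (b * c' + c)))"
      by (rule ext) (auto simp: e poly_pcompose algebra_simps)
    finally have "e ^^ Suc n = (\<lambda>(x, y). ((a * a') * x + poly ?q y, (b * b') * y + (b * c' + c)))" .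
    moreover have "degree (pcompose p [:c', b':]) \<le> degree p * 1"
      using degree_pcompose_le[of p "[:c', b':]"] by (rule order.trans) (simp split: if_splits)
    then have "degree ?q \<le> degree p" using *(1) by (intro degree_add_le) (auto simp: degree_smult_le)
    ultimately show ?case by blast
  qed
  have "map_bounded (max 1 (degree p)) (e ^^ n)" for n
  proof -
    obtain a' b' c' p' where *: "degree p' \<le> degree p" "e ^^ n = (\<lambda>(x, y). (a' * x + poly p' y, b' * y + c'))"
      using iterates[of n] by blast
    show ?thesis unfolding *(2) by (rule map_bounded_mono[OF map_bounded_elementary]) (use *(1) in auto)
  qed
  then show ?thesis unfolding bounded_degree_growth_def by blast
qed

lemma bounded_degree_growth_affine:
  assumes "affine_automorphism f" shows "bounded_degree_growth f"
proof -
  have "map_bounded 1 f" using assms degree_bounded_linear by (auto simp: affine_automorphism_def map_bounded_def case_prod_unfold)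
  then have "map_bounded 1 (f ^^ n)" for n
  proof (induction n)
    case 0
    then show ?case using map_bounded_id by (simp add: id_def)
  next
    case (Suc n)
    then show ?case using map_bounded_compose[of 1 f 1 "f ^^ n"] by (simp add: comp_def)
  qed
  then show ?thesis unfolding bounded_degree_growth_def by blast
qed

lemma conjugate_funpow:
  assumes "plane_automorphism \<phi>" "f = \<phi> \<circ> h \<circ> inv \<phi>"
  shows "f ^^ n = \<phi> \<circ> h ^^ n \<circ> inv \<phi>"
proof (induction n)
  case 0
  then show ?case using assms(1) by (simp add: plane_automorphism_def bij_is_surj surj_iff[THEN iffD1])
next
  case (Suc n)
  have "inv \<phi> \<circ> \<phi> = id" using assms(1) by (simp add: plane_automorphism_def bij_is_inj)
  then have inv: "inv \<phi> (\<phi> x) = x" for x by (metis comp_apply id_apply)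
  have "f ^^ Suc n = f \<circ> (\<phi> \<circ> h ^^ n \<circ> inv \<phi>)" by (simp only: funpow.simps Suc)
  also have "\<dots> = \<phi> \<circ> h ^^ Suc n \<circ> inv \<phi>" by (rule ext) (simp add: assms(2) inv)
  finally show ?case .
qed

lemma bounded_degree_growth_conjugate:
  assumes "conjugate f h" "bounded_degree_growth h" shows "bounded_degree_growth f"
proof -
  obtain \<phi> where \<phi>: "plane_automorphism \<phi>" "f = \<phi> \<circ> h \<circ> inv \<phi>" using assms(1) by (auto simp: conjugate_def)
  obtain d d' d'' where "map_bounded d \<phi>" "map_bounded d' (inv \<phi>)" "\<And>n. map_bounded d'' (h ^^ n)"
    using \<phi>(1) assms(2) by (auto simp: plane_automorphism_def bounded_degree_growth_def)
  then have "map_bounded (d * d'' * d') (f ^^ n)" for n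
    unfolding conjugate_funpow[OF \<phi>] by (intro map_bounded_compose)
  then show ?thesis unfolding bounded_degree_growth_def by blast
qed

lemma plane_automorphism_continuous: "plane_automorphism f \<Longrightarrow> continuous_on UNIV f"
  using continuous_on_Pair[of UNIV "\<lambda>z. fst (f z)" "\<lambda>z. snd (f z)"] degree_bounded_continuous
  by (auto simp: plane_automorphism_def map_bounded_def)

text \<open>
  Convergence of orbits is preserved under conjugation by a homeomorphism, which rules out
  compositions of Henon maps.
\<close>

theorem convergent_orbits_bounded_degree_growth:
  assumes "plane_automorphism \<gamma>" and lim: "\<And>z. (\<lambda>n. (\<gamma> ^^ n) z) \<longlonglongrightarrow> l"
  shows "bounded_degree_growth \<gamma>"
proof -
  obtain h where h: "conjugate \<gamma> h"
    "elementary h \<or> affine_automorphism h \<or> (\<exists>es. es \<noteq> [] \<and> (\<forall>e\<in>set es. henon_factor e) \<and> h = henon_word es)"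
    using friedland_milnor_trichotomy[OF assms(1)] .
  have "\<not> (es \<noteq> [] \<and> (\<forall>e\<in>set es. henon_factor e) \<and> h = henon_word es)" for es
  proof
    assume es: "es \<noteq> [] \<and> (\<forall>e\<in>set es. henon_factor e) \<and> h = henon_word es"
    then obtain z where z: "\<And>n. 2 ^ n \<le> norm (snd ((h ^^ n) z))" using henon_word_unbounded by metis
    obtain \<phi> where \<phi>: "plane_automorphism \<phi>" "\<gamma> = \<phi> \<circ> h \<circ> inv \<phi>" using h(1) by (auto simp: conjugate_def)
    have inv: "inv \<phi> (\<phi> x) = x" for x using \<phi>(1) by (simp add: plane_automorphism_def bij_is_inj)
    have "(h ^^ n) z = inv \<phi> ((\<gamma> ^^ n) (\<phi> z))" for n
      unfolding conjugate_funpow[OF \<phi>] by (simp add: inv)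
    moreover have "(\<lambda>n. inv \<phi> ((\<gamma> ^^ n) (\<phi> z))) \<longlonglongrightarrow> inv \<phi> l"
      using plane_automorphism_continuous[OF plane_automorphism_inv[OF \<phi>(1)]] lim[of "\<phi> z"]
      by (rule continuous_on_tendsto_compose) simp_all
    ultimately have "(\<lambda>n. snd ((h ^^ n) z)) \<longlonglongrightarrow> snd (inv \<phi> l)" by (simp add: tendsto_snd)
    then have "Bseq (\<lambda>n. snd ((h ^^ n) z))" by (rule convergentI[THEN convergent_imp_Bseq])
    then obtain K where K: "\<And>n. norm (snd ((h ^^ n) z)) \<le> K" by (auto simp: Bseq_def)
    obtain n where "K < 2 ^ n" using real_arch_pow[of 2 K] by auto
    then show False using K[of n] z[of n] by linarith
  qed
  then show ?thesis using h bounded_degree_growth_conjugate bounded_degree_growth_elementary bounded_degree_growth_affine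
    by blast
qed

section \<open>Transfer to vectors and coordinate polynomials\<close>

definition to_vec :: "complex \<times> complex \<Rightarrow> complex ^ 2" where "to_vec z = vector [fst z, snd z]"
definition of_vec :: "complex ^ 2 \<Rightarrow> complex \<times> complex" where "of_vec v = (v $ 1, v $ 2)"

lemma vec_inverse [simp]: "of_vec (to_vec z) = z" "to_vec (of_vec v) = v"
  by (simp_all add: to_vec_def of_vec_def vec_eq_iff forall_2)

lemma total_degree_le_iff:
  "total_degree p \<le> d \<longleftrightarrow> (\<forall>m\<in>Poly_Mapping.keys p. (\<Sum>i\<in>UNIV. Poly_Mapping.lookup m i) \<le> d)"
  by (auto simp: total_degree_def)

lemma degree_bounded_eval_cpoly: "\<exists>d. degree_bounded d (\<lambda>z. eval_cpoly p (to_vec z))"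
proof
  define d where "d = total_degree p"
  have "degree_bounded d (\<lambda>z. fst z ^ Poly_Mapping.lookup m 1 * snd z ^ Poly_Mapping.lookup m 2)" if "m \<in> Poly_Mapping.keys p" for m
  proof (rule degree_bounded_mono[OF degree_bounded_mult[OF degree_bounded_power[OF degree_bounded_fst] degree_bounded_power[OF degree_bounded_snd]]])
    have "total_degree p \<le> d" by (simp add: d_def)
    then show "Poly_Mapping.lookup m 1 * 1 + Poly_Mapping.lookup m 2 * 1 \<le> d"
      unfolding total_degree_le_iff using that by (auto simp: sum_2)
  qed
  then show "degree_bounded d (\<lambda>z. eval_cpoly p (to_vec z))"
    unfolding eval_cpoly_def by (intro degree_bounded_sum degree_bounded_cmult) (simp add: UNIV_2 to_vec_def)
qed

definition represents :: "nat \<Rightarrow> (complex \<times> complex \<Rightarrow> complex) \<Rightarrow> 2 cpoly \<Rightarrow> bool" where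
  "represents d h P \<longleftrightarrow> total_degree P \<le> d \<and> (\<forall>v. eval_cpoly P v = h (of_vec v))"

lemma represents_monomial:
  assumes "i + j \<le> d"
  shows "\<exists>P. represents d (\<lambda>z. c * (fst z ^ i * snd z ^ j)) P"
proof -
  define m :: "2 \<Rightarrow>\<^sub>0 nat" where "m = Poly_Mapping.single 1 i + Poly_Mapping.single 2 j"
  have m: "Poly_Mapping.lookup m 1 = i" "Poly_Mapping.lookup m 2 = j"
    by (simp_all add: m_def lookup_add lookup_single)
  have keys: "Poly_Mapping.keys (Poly_Mapping.single m c) \<subseteq> {m}" by simp
  have "represents d (\<lambda>z. c * (fst z ^ i * snd z ^ j)) (Poly_Mapping.single m c)"
    unfolding represents_def total_degree_le_iff
  proof (intro conjI allI ballI)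
    fix m' assume "m' \<in> Poly_Mapping.keys (Poly_Mapping.single m c)"
    then have "m' = m" using keys by blast
    then show "(\<Sum>i\<in>UNIV. Poly_Mapping.lookup m' i) \<le> d" using assms m by (simp add: sum_2)
  qed (use eval_cpoly_superset[OF _ keys] in \<open>simp add: m UNIV_2 of_vec_def\<close>)
  then show ?thesis ..
qed

lemma represents_sum:
  assumes "\<And>i. i \<in> I \<Longrightarrow> \<exists>P. represents d (h i) P"
  shows "\<exists>P. represents d (\<lambda>z. \<Sum>i\<in>I. h i z) P"
  using assms
proof (induction I rule: infinite_finite_induct)
  case (insert i I)
  obtain P Q where PQ: "represents d (h i) P" "represents d (\<lambda>z. \<Sum>i\<in>I. h i z) Q"
    using insert.IH insert.prems by (metis insertCI)
  let ?S = "Poly_Mapping.keys P \<union> Poly_Mapping.keys Q"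
  have keys: "Poly_Mapping.keys (P + Q) \<subseteq> ?S" by (rule Poly_Mapping.keys_add)
  have "eval_cpoly (P + Q) v = eval_cpoly P v + eval_cpoly Q v" for v
    using eval_cpoly_superset[of ?S "P + Q"] eval_cpoly_superset[of ?S P] eval_cpoly_superset[of ?S Q] keys
    by (simp add: lookup_add distrib_right sum.distrib)
  then have "represents d (\<lambda>z. \<Sum>i\<in>insert i I. h i z) (P + Q)"
    using PQ keys insert.hyps unfolding represents_def total_degree_le_iff by auto
  then show ?case ..
qed (auto simp: represents_def total_degree_le_iff eval_cpoly_def intro!: exI[of _ 0])

lemma degree_bounded_represents:
  assumes "degree_bounded d h" shows "\<exists>P. represents d h P"
proof -
  obtain F where F: "chart F h" "degree F \<le> d" using chart_exists[OF assms] .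
  have "h = (\<lambda>z. \<Sum>k\<le>degree F. \<Sum>j\<le>k. coeff (coeff F k) j * (fst z ^ (k - j) * snd z ^ j))"
    using chart_expand[OF assms F(1)] by auto
  moreover have "\<exists>P. represents d \<dots> P"
    using F(2) by (intro represents_sum represents_monomial) auto
  ultimately show ?thesis by simp
qed

lemma polynomial_map_map_bounded:
  assumes "polynomial_map f" shows "\<exists>d. map_bounded d (of_vec \<circ> f \<circ> to_vec)"
proof -
  obtain P where P: "\<And>x i. f x $ i = eval_cpoly (P i) x" using assms by (auto simp: polynomial_map_def given_by_def)
  obtain d1 d2 where d: "degree_bounded d1 (\<lambda>z. eval_cpoly (P 1) (to_vec z))" "degree_bounded d2 (\<lambda>z. eval_cpoly (P 2) (to_vec z))"
    using degree_bounded_eval_cpoly by metis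
  have "map_bounded (max d1 d2) (of_vec \<circ> f \<circ> to_vec)"
    unfolding map_bounded_def using degree_bounded_mono[OF d(1), of "max d1 d2"] degree_bounded_mono[OF d(2), of "max d1 d2"]
    by (simp add: of_vec_def P)
  then show ?thesis ..
qed

lemma map_degree_le:
  assumes "map_bounded d (of_vec \<circ> f \<circ> to_vec)"
  shows "map_degree f \<le> d"
proof -
  obtain P1 P2 where "represents d (\<lambda>z. fst ((of_vec \<circ> f \<circ> to_vec) z)) P1" "represents d (\<lambda>z. snd ((of_vec \<circ> f \<circ> to_vec) z)) P2"
    using assms degree_bounded_represents unfolding map_bounded_def by blast
  then have P: "total_degree P1 \<le> d" "total_degree P2 \<le> d" "\<And>v. eval_cpoly P1 v = f v $ 1" "\<And>v. eval_cpoly P2 v = f v $ 2"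
    unfolding represents_def by (simp_all add: of_vec_def[of "f _"])
  define P where "P i = (if i = 1 then P1 else P2)" for i :: 2
  have "given_by f P" unfolding given_by_def by (auto simp: P P_def forall_2)
  then have "coordinate_polys f = P" by (rule coordinate_polys_eq)
  then show ?thesis unfolding map_degree_def by (auto simp: P_def P)
qed

lemma vec_conjugate_funpow: "(of_vec \<circ> f \<circ> to_vec) ^^ n = of_vec \<circ> f ^^ n \<circ> to_vec"
  by (induction n) (auto simp: fun_eq_iff)

lemma plane_automorphism_of_polynomial_automorphism:
  assumes "polynomial_automorphism f" shows "plane_automorphism (of_vec \<circ> f \<circ> to_vec)"
proof -
  have f: "bij f" "polynomial_map f" "polynomial_map (inv f)" using assms by (auto simp: polynomial_automorphism_def)
  obtain d d' where "map_bounded d (of_vec \<circ> f \<circ> to_vec)" "map_bounded d' (of_vec \<circ> inv f \<circ> to_vec)"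
    using f polynomial_map_map_bounded by blast
  then show ?thesis
    by (rule plane_automorphismI) (use f(1) in \<open>auto simp: fun_eq_iff bij_is_surj surj_f_inv_f bij_is_inj\<close>)
qed

theorem theorem1:
  fixes \<gamma> :: "complex ^ 2 \<Rightarrow> complex ^ 2"
  assumes "polynomial_automorphism \<gamma>"
    and "contraction \<gamma>"
  shows "bdd_above (range (\<lambda>n::nat. map_degree (\<gamma> ^^ n)))"
proof -
  let ?g = "of_vec \<circ> \<gamma> \<circ> to_vec"
  have "(\<lambda>n. (?g ^^ n) z) \<longlonglongrightarrow> (0, 0)" for z
  proof -
    have "(\<lambda>n. (\<gamma> ^^ n) (to_vec z)) \<longlonglongrightarrow> 0" using assms(2) by (simp add: contraction_def)
    then have "(\<lambda>n. (\<gamma> ^^ n) (to_vec z) $ i) \<longlonglongrightarrow> 0" for i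
      using tendsto_vec_nth[of "\<lambda>n. (\<gamma> ^^ n) (to_vec z)" 0 sequentially i] by simp
    then show ?thesis unfolding vec_conjugate_funpow by (auto simp: of_vec_def intro!: tendsto_Pair)
  qed
  then have "bounded_degree_growth ?g"
    by (rule convergent_orbits_bounded_degree_growth[OF plane_automorphism_of_polynomial_automorphism[OF assms(1)]])
  then obtain d where "\<And>n. map_bounded d (?g ^^ n)" by (auto simp: bounded_degree_growth_def)
  then have "map_degree (\<gamma> ^^ n) \<le> d" for n unfolding vec_conjugate_funpow by (rule map_degree_le)
  then show ?thesis by (intro bdd_aboveI[of _ d]) auto
qed

end
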